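(* Let $(R,\mathfrak m,k)$ be an $F$-finite regular local ring of characteristic $p>0$, with maps $\Delta_n\colon R\to R/F(R)$ as in the context. For all $n\ge1$ and all $f\in R$, $$\Delta_n(f)=f^{p^n-p}\,\Delta_1(f)\quad\text{in }R/F(R).$$
   Context: $F(R)=\{b^p\mid b\in R\}$; since $p\mid p^n-p$, multiplication by $f^{p^n-p}$ is well defined on $R/F(R)$. $F_*R$ is $R$ with $R$-action $a\cdot F_*b=F_*(a^pb)$. Fix $x_1,\dots,x_N\in R$ such that $\{F_*(x_1^{i_1}\cdots x_N^{i_N})\mid0\le i_j\le p-1\}$ is a basis of $F_*R$ over $R$ (such elements exist), and write $v_1,\dots,v_d$ for the elements $x_1^{i_1}\cdots x_N^{i_N}$, $0\le i_j\le p-1$. A $p$-monomial is an element $b^pv_i$ with $b\in R$. Let $W(R)$ be the ring of $p$-typical Witt vectors, $[a]$ the Teichmüller lift, $V$ the Verschiebung, $\overline W(R):=W(R)/pW(R)$ with induced $V$. Let $\overline W(R)/[F(R)]$ be the cokernel of the additive map $R\to\overline W(R)$, $a\mapsto[a^p]$; $V$ induces an injective additive map $V\colon\overline W(R)/[F(R)]\to\overline W(R)$ with image $\operatorname{Im}(V)$. For each $\alpha\in\overline W(R)$ there is a unique $\Delta_W(\alpha)\in\overline W(R)/[F(R)]$ such that $\alpha-V\Delta_W(\alpha)$ is a sum of Teichmüller lifts of $p$-monomials. The map $\Delta_W$ factors through $\overline\Delta_W\colon\overline W(R)/[F(R)]\to\overline W(R)/[F(R)]$. For $r\ge1$, $\Delta_r(a)\in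 R/F(R)$ is the zeroth component of $\overline\Delta_W^{\,r}([a])$ ($r$-fold composition). *)

theory Defs
  imports
    "HOL-Algebra.Ring_Divisibility"
    "HOL-Library.Poly_Mapping"
    "HOL-Library.Extended_Nat"
    "HOL-Computational_Algebra.Primes"
begin

section \<open>Regular local rings\<close>

definition krull_dim :: "('a, 'b) ring_scheme \<Rightarrow> enat" where
  "krull_dim R =
     Sup {enat k |k. \<exists>P :: nat \<Rightarrow> 'a set.
        (\<forall>i\<le>k. primeideal (P i) R) \<and> (\<forall>i<k. P i \<subset> P (Suc i))}"

locale noetherian_local_ring = cring R + noetherian_ring R
  for R (structure) and \<mm> +
  assumes maximal: "maximalideal \<mm> R"
    and maximal_unique: "maximalideal J R \<Longrightarrow> J = \<mm>"

locale regular_local_ring = noetherian_local_ring +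
  assumes regular:
    "\<exists>A. finite A \<and> A \<subseteq> carrier R \<and> Idl A = \<mm> \<and> enat (card A) = krull_dim R"

section \<open>Modules\<close>

definition finitely_generated_module ::
    "('a, 'r) ring_scheme \<Rightarrow> ('a, 'c, 'm) module_scheme \<Rightarrow> bool" where
  "finitely_generated_module R M \<longleftrightarrow>
     (\<exists>A. finite A \<and> A \<subseteq> carrier M \<and>
        (\<forall>y \<in> carrier M. \<exists>c \<in> A \<rightarrow> carrier R. y = (\<Oplus>\<^bsub>M\<^esub>a\<in>A. c a \<odot>\<^bsub>M\<^esub> a)))"

text \<open>A basis is a family indexed by a finite set, so repetitions are excluded by linear
  independence.\<close>

definition module_basis ::
    "('a, 'r) ring_scheme \<Rightarrow> ('a, 'c, 'm) module_scheme \<Rightarrow> 'i set \<Rightarrow> ('i \<Rightarrow> 'c) \<Rightarrow> bool" where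
  "module_basis R M I v \<longleftrightarrow>
     finite I \<and> v \<in> I \<rightarrow> carrier M \<and>
     (\<forall>y \<in> carrier M. \<exists>c \<in> I \<rightarrow> carrier R. y = (\<Oplus>\<^bsub>M\<^esub>i\<in>I. c i \<odot>\<^bsub>M\<^esub> v i)) \<and>
     (\<forall>c \<in> I \<rightarrow> carrier R. (\<Oplus>\<^bsub>M\<^esub>i\<in>I. c i \<odot>\<^bsub>M\<^esub> v i) = \<zero>\<^bsub>M\<^esub> \<longrightarrow> (\<forall>i\<in>I. c i = \<zero>\<^bsub>R\<^esub>))"

section \<open>Frobenius\<close>

text \<open>The module \<open>F\<^sub>* R\<close>; its element \<open>F\<^sub>* b\<close> is represented by \<open>b\<close> itself.\<close>

definition frob_pushforward :: "('a, 'b) ring_scheme \<Rightarrow> nat \<Rightarrow> ('a, 'a) module" where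
  "frob_pushforward R p =
     \<lparr>carrier = carrier R, monoid.mult = monoid.mult R, one = one R, zero = zero R, add = add R,
      smult = (\<lambda>a b. (a [^]\<^bsub>R\<^esub> p) \<otimes>\<^bsub>R\<^esub> b)\<rparr>"

definition F_finite :: "('a, 'b) ring_scheme \<Rightarrow> nat \<Rightarrow> bool" where
  "F_finite R p \<longleftrightarrow> finitely_generated_module R (frob_pushforward R p)"

definition frob_image :: "('a, 'b) ring_scheme \<Rightarrow> nat \<Rightarrow> 'a set" where
  "frob_image R p = {b [^]\<^bsub>R\<^esub> p |b. b \<in> carrier R}"

text \<open>Multiplication by \<open>c\<close> on the additive group \<open>R A_Mod frob_image R p\<close>, whose elements
  are cosets; it is well defined when \<open>c\<close> is a \<open>p\<close>-th power. As in the library's homomorphism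
  theorem, a map \<open>h\<close> that is constant on cosets induces the map \<open>\<lambda>X. the_elem (h ` X)\<close>.\<close>

definition frob_quot_mult :: "('a, 'b) ring_scheme \<Rightarrow> nat \<Rightarrow> 'a \<Rightarrow> 'a set \<Rightarrow> 'a set" where
  "frob_quot_mult R p c X = the_elem ((\<lambda>b. frob_image R p +>\<^bsub>R\<^esub> (c \<otimes>\<^bsub>R\<^esub> b)) ` X)"

definition frob_monomial :: "('a, 'b) ring_scheme \<Rightarrow> nat \<Rightarrow> (nat \<Rightarrow> 'a) \<Rightarrow> (nat \<Rightarrow> nat) \<Rightarrow> 'a" where
  "frob_monomial R N x e = (\<Otimes>\<^bsub>R\<^esub>j\<in>{1..N}. x j [^]\<^bsub>R\<^esub> e j)"

abbreviation frob_exponents :: "nat \<Rightarrow> nat \<Rightarrow> (nat \<Rightarrow> nat) set" where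
  "frob_exponents p N \<equiv> {1..N} \<rightarrow>\<^sub>E {0..p - 1}"

definition p_monomials :: "('a, 'b) ring_scheme \<Rightarrow> nat \<Rightarrow> nat \<Rightarrow> (nat \<Rightarrow> 'a) \<Rightarrow> 'a set" where
  "p_monomials R p N x =
     {(b [^]\<^bsub>R\<^esub> p) \<otimes>\<^bsub>R\<^esub> frob_monomial R N x e |b e. b \<in> carrier R \<and> e \<in> frob_exponents p N}"

section \<open>Witt vectors\<close>

text \<open>Integer polynomials in variables of type \<open>'v\<close>: finitely supported maps from monomials,
  which are themselves finitely supported exponent functions, to coefficients.\<close>

type_synonym 'v zpoly = "('v \<Rightarrow>\<^sub>0 nat) \<Rightarrow>\<^sub>0 int"

definition zvar :: "'v \<Rightarrow> 'v zpoly" where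
  "zvar v = Poly_Mapping.single (Poly_Mapping.single v 1) 1"

definition zpoly_eval :: "('a, 'b) ring_scheme \<Rightarrow> ('v \<Rightarrow> 'a) \<Rightarrow> 'v zpoly \<Rightarrow> 'a" where
  "zpoly_eval R \<rho> P =
     (\<Oplus>\<^bsub>R\<^esub>m\<in>Poly_Mapping.keys P.
        [Poly_Mapping.lookup P m] \<cdot>\<^bsub>R\<^esub>
          (\<Otimes>\<^bsub>R\<^esub>v\<in>Poly_Mapping.keys m. \<rho> v [^]\<^bsub>R\<^esub> Poly_Mapping.lookup m v))"

definition witt_poly :: "nat \<Rightarrow> nat \<Rightarrow> (nat \<Rightarrow> 'c::comm_ring_1) \<Rightarrow> 'c" where
  "witt_poly p n X = (\<Sum>i\<le>n. of_nat p ^ i * X i ^ (p ^ (n - i)))"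

text \<open>The unique integer polynomials \<open>S\<^sub>0, S\<^sub>1, \<dots>\<close> in the variables \<open>X\<^sub>i\<close> (\<open>Inl i\<close>) and
  \<open>Y\<^sub>i\<close> (\<open>Inr i\<close>) with \<open>w\<^sub>n(S\<^sub>0, \<dots>, S\<^sub>n) = w\<^sub>n(X) \<star> w\<^sub>n(Y)\<close> for all \<open>n\<close>.\<close>

definition witt_structure_poly ::
    "nat \<Rightarrow> ((nat + nat) zpoly \<Rightarrow> (nat + nat) zpoly \<Rightarrow> (nat + nat) zpoly)
      \<Rightarrow> nat \<Rightarrow> (nat + nat) zpoly" where
  "witt_structure_poly p star =
     (THE S. \<forall>n. witt_poly p n S =
        star (witt_poly p n (\<lambda>i. zvar (Inl i))) (witt_poly p n (\<lambda>i. zvar (Inr i))))"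

definition teich :: "('a, 'b) ring_scheme \<Rightarrow> 'a \<Rightarrow> nat \<Rightarrow> 'a" where
  "teich R a = (\<lambda>n. case n of 0 \<Rightarrow> a | Suc _ \<Rightarrow> \<zero>\<^bsub>R\<^esub>)"

definition versch :: "('a, 'b) ring_scheme \<Rightarrow> (nat \<Rightarrow> 'a) \<Rightarrow> nat \<Rightarrow> 'a" where
  "versch R w = (\<lambda>n. case n of 0 \<Rightarrow> \<zero>\<^bsub>R\<^esub> | Suc m \<Rightarrow> w m)"

definition witt_ring :: "('a, 'b) ring_scheme \<Rightarrow> nat \<Rightarrow> (nat \<Rightarrow> 'a) ring" where
  "witt_ring R p =
     \<lparr>carrier = UNIV \<rightarrow> carrier R,
      monoid.mult = (\<lambda>a b n. zpoly_eval R (case_sum a b) (witt_structure_poly p (*) n)),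
      one = teich R \<one>\<^bsub>R\<^esub>,
      zero = (\<lambda>_. \<zero>\<^bsub>R\<^esub>),
      add = (\<lambda>a b n. zpoly_eval R (case_sum a b) (witt_structure_poly p (+) n))\<rparr>"

section \<open>Witt vectors modulo \<open>p\<close>\<close>

definition witt_p_ideal :: "('a, 'b) ring_scheme \<Rightarrow> nat \<Rightarrow> (nat \<Rightarrow> 'a) set" where
  "witt_p_ideal R p = PIdl\<^bsub>witt_ring R p\<^esub> ([p] \<cdot>\<^bsub>witt_ring R p\<^esub> \<one>\<^bsub>witt_ring R p\<^esub>)"

definition Wbar :: "('a, 'b) ring_scheme \<Rightarrow> nat \<Rightarrow> (nat \<Rightarrow> 'a) set ring" where
  "Wbar R p = witt_ring R p Quot witt_p_ideal R p"

definition Wbar_of :: "('a, 'b) ring_scheme \<Rightarrow> nat \<Rightarrow> (nat \<Rightarrow> 'a) \<Rightarrow> (nat \<Rightarrow> 'a) set" where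
  "Wbar_of R p w = witt_p_ideal R p +>\<^bsub>witt_ring R p\<^esub> w"

definition Wbar_teich :: "('a, 'b) ring_scheme \<Rightarrow> nat \<Rightarrow> 'a \<Rightarrow> (nat \<Rightarrow> 'a) set" where
  "Wbar_teich R p a = Wbar_of R p (teich R a)"

definition Wbar_versch ::
    "('a, 'b) ring_scheme \<Rightarrow> nat \<Rightarrow> (nat \<Rightarrow> 'a) set \<Rightarrow> (nat \<Rightarrow> 'a) set" where
  "Wbar_versch R p \<alpha> = the_elem ((\<lambda>w. Wbar_of R p (versch R w)) ` \<alpha>)"

definition Wbar_component0 :: "('a, 'b) ring_scheme \<Rightarrow> nat \<Rightarrow> (nat \<Rightarrow> 'a) set \<Rightarrow> 'a" where
  "Wbar_component0 R p \<alpha> = the_elem ((\<lambda>w. w 0) ` \<alpha>)"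

text \<open>The image of \<open>a \<mapsto> [a\<^sup>p]\<close>, and the cokernel of this map, with the maps that it
  receives and induces.\<close>

definition Wbar_frob :: "('a, 'b) ring_scheme \<Rightarrow> nat \<Rightarrow> (nat \<Rightarrow> 'a) set set" where
  "Wbar_frob R p = (\<lambda>a. Wbar_teich R p (a [^]\<^bsub>R\<^esub> p)) ` carrier R"

definition Wcoker :: "('a, 'b) ring_scheme \<Rightarrow> nat \<Rightarrow> (nat \<Rightarrow> 'a) set set monoid" where
  "Wcoker R p = Wbar R p A_Mod Wbar_frob R p"

definition Wcoker_of ::
    "('a, 'b) ring_scheme \<Rightarrow> nat \<Rightarrow> (nat \<Rightarrow> 'a) set \<Rightarrow> (nat \<Rightarrow> 'a) set set" where
  "Wcoker_of R p \<alpha> = Wbar_frob R p +>\<^bsub>Wbar R p\<^esub> \<alpha>"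

definition Wcoker_versch ::
    "('a, 'b) ring_scheme \<Rightarrow> nat \<Rightarrow> (nat \<Rightarrow> 'a) set set \<Rightarrow> (nat \<Rightarrow> 'a) set" where
  "Wcoker_versch R p X = the_elem (Wbar_versch R p ` X)"

definition Wcoker_component0 ::
    "('a, 'b) ring_scheme \<Rightarrow> nat \<Rightarrow> (nat \<Rightarrow> 'a) set set \<Rightarrow> 'a set" where
  "Wcoker_component0 R p X =
     the_elem ((\<lambda>\<alpha>. frob_image R p +>\<^bsub>R\<^esub> Wbar_component0 R p \<alpha>) ` X)"

section \<open>The maps \<open>\<Delta>\<close>\<close>

definition p_monomial_teich_sums ::
    "('a, 'b) ring_scheme \<Rightarrow> nat \<Rightarrow> nat \<Rightarrow> (nat \<Rightarrow> 'a) \<Rightarrow> (nat \<Rightarrow> 'a) set set" where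
  "p_monomial_teich_sums R p N x =
     {(\<Oplus>\<^bsub>Wbar R p\<^esub>i\<in>{..<k}. Wbar_teich R p (m i)) |(k::nat) m.
        m \<in> {..<k} \<rightarrow> p_monomials R p N x}"

definition Delta_W ::
    "('a, 'b) ring_scheme \<Rightarrow> nat \<Rightarrow> nat \<Rightarrow> (nat \<Rightarrow> 'a) \<Rightarrow> (nat \<Rightarrow> 'a) set \<Rightarrow> (nat \<Rightarrow> 'a) set set" where
  "Delta_W R p N x \<alpha> =
     (THE D. D \<in> carrier (Wcoker R p) \<and>
        \<alpha> \<ominus>\<^bsub>Wbar R p\<^esub> Wcoker_versch R p D \<in> p_monomial_teich_sums R p N x)"

definition Delta_W_bar ::
    "('a, 'b) ring_scheme \<Rightarrow> nat \<Rightarrow> nat \<Rightarrow> (nat \<Rightarrow> 'a) \<Rightarrow> (nat \<Rightarrow> 'a) set set \<Rightarrow> (nat \<Rightarrow> 'a) set set" where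
  "Delta_W_bar R p N x X = the_elem (Delta_W R p N x ` X)"

definition Delta :: "('a, 'b) ring_scheme \<Rightarrow> nat \<Rightarrow> nat \<Rightarrow> (nat \<Rightarrow> 'a) \<Rightarrow> nat \<Rightarrow> 'a \<Rightarrow> 'a set" where
  "Delta R p N x r a =
     Wcoker_component0 R p ((Delta_W_bar R p N x ^^ r) (Wcoker_of R p (Wbar_teich R p a)))"

end

theory Submission
  imports Defs "HOL-Algebra.Algebraic_Closure_Type"
begin

text \<open>Work in \<open>W(R)\<close>, which has no \<open>p\<close>-torsion because the Frobenius of \<open>R\<close> is injective. Let
  \<open>f\<close> be the sum of the \<open>p\<close>-monomials \<open>m\<^sub>e\<close>, let \<open>y\<close> be the sum of their Teichmueller lifts, and
  write \<open>[f] = y + V D\<close>. Applying \<open>F\<close> gives \<open>p D = [f]\<^sup>p - F y = (y + V D)\<^sup>p - F y\<close>. Here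
  \<open>y\<^sup>p - F y\<close> is \<open>p\<close> times an integral polynomial in the \<open>[m\<^sub>e]\<close>, and beyond the linear term the powers
  of \<open>V D\<close> contribute multiples of \<open>p\<^sup>2\<close>. Dividing by \<open>p\<close> shows that, modulo \<open>p\<close> and sums of
  Teichmueller lifts of \<open>p\<close>-monomials, \<open>D\<close> equals \<open>y\<^bsup>p-1\<^esup> V D = V ([f\<^bsup>p(p-1)\<^esup>] D)\<close>. Hence
  \<open>\<Delta>\<close> sends the class of \<open>D = \<Delta> [f]\<close> to \<open>[f\<^bsup>p(p-1)\<^esup>] D\<close>, and since
  \<open>\<Delta> ([a\<^sup>p] D) = [a\<^bsup>p\<^sup>2\<^esup>] \<Delta> D\<close>, iterating gives the formula.\<close>

section \<open>Evaluation of integer polynomials\<close>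

text \<open>Division by p occurs in two places, and both shape the proof. Over R itself, where p =
  0, ghost components lose all but the zeroth component; so the ring laws of W(R) and the identities
  for F and V are checked on integer polynomials, where p can be cancelled, and then projected to R.
  The second division is that of p D: it is impossible in W(R)/p, so the computation uses a
  representative D in W(R) and is reduced only afterwards.

  The polynomial error terms are absorbed because sums of Teichmueller lifts of p-monomials form a
  subring of W(R)/p: a product of p-monomials is again one, and [a^p] + [b^p] = [(a + b)^p] modulo
  p. The factor f^(p(p-1)) comes from y^(p-1) V D = V (F(y)^(p-1) D): since F V = p, the class of F
  y depends only on the zeroth component f of y. In the iteration an exponent a turns into p a +
  (p^2 - p); starting from 0 at n = 1 this gives p^n - p.\<close>

abbreviation type_ring :: "'a::comm_ring_1 ring" where
  "type_ring \<equiv> ring_of_type_algebra"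

lemma type_ring_simps [simp]:
  "carrier (type_ring :: 'a::comm_ring_1 ring) = UNIV"
  "\<one>\<^bsub>type_ring\<^esub> = (1 :: 'a)" "\<zero>\<^bsub>type_ring\<^esub> = (0 :: 'a)"
  "a \<otimes>\<^bsub>type_ring\<^esub> b = a * (b :: 'a)" "a \<oplus>\<^bsub>type_ring\<^esub> b = a + (b :: 'a)"
  by (simp_all add: ring_of_type_algebra_def)

lemma cring_type_ring [simp]: "cring (type_ring :: 'a::comm_ring_1 ring)"
  by (rule cring_from_type_algebra)

lemma update_conv_add_single:
  fixes f :: "'a \<Rightarrow>\<^sub>0 'b::monoid_add"
  assumes "a \<notin> Poly_Mapping.keys f"
  shows "Poly_Mapping.update a b f = f + Poly_Mapping.single a b"
  using assms by (intro poly_mapping_eqI)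
    (auto simp: Poly_Mapping.update.rep_eq lookup_add lookup_single when_def in_keys_iff)

lemma zpoly_induct_single [case_names zero add]:
  fixes P :: "'v zpoly"
  assumes "Q 0" and "\<And>P m c. Q P \<Longrightarrow> Q (P + Poly_Mapping.single m c)"
  shows "Q P"
proof (induction P rule: update_induct)
  case (update f a b)
  have "Poly_Mapping.update a b f = f + Poly_Mapping.single a b"
    using update(1) by (rule update_conv_add_single)
  then show ?case using assms(2) update by simp
qed (rule assms(1))

text \<open>The variables generate the polynomial ring over the integers, so closure under the ring
  operations suffices. This spares monomial bookkeeping in the Frobenius congruence and in the
  naturality of evaluation.\<close>

lemma zpoly_induct [case_names one add neg mult var]:
  fixes P :: "'v zpoly"
  assumes one: "Q 1" and add: "\<And>a b. Q a \<Longrightarrow> Q b \<Longrightarrow> Q (a + b)" and neg: "\<And>a. Q a \<Longrightarrow> Q (- a)"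
    and mult: "\<And>a b. Q a \<Longrightarrow> Q b \<Longrightarrow> Q (a * b)" and var: "\<And>v. Q (zvar v)"
  shows "Q P"
proof -
  have zero: "Q 0" using add[OF one neg[OF one]] by simp
  have int: "Q (of_int c)" for c :: int
  proof (induction c rule: int_induct[where k = 0])
    case (step2 i) then show ?case using add[OF _ neg[OF one]] by force
  qed (simp_all add: zero add one)
  have pow: "Q (zvar v ^ k)" for v k
    by (induction k) (simp_all add: one mult var)
  have pow_eq: "zvar v ^ k = (Poly_Mapping.single (Poly_Mapping.single v k) 1 :: 'v zpoly)" for v k
    by (induction k) (simp_all add: zvar_def mult_single single_add[symmetric])
  have mon: "Q (Poly_Mapping.single m 1)" for m
  proof (induction m rule: update_induct)
    case const show ?case using one by simp
  next
    case (update f a b)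
    have "Poly_Mapping.update a b f = f + Poly_Mapping.single a b"
      using update(1) by (rule update_conv_add_single)
    then have "Poly_Mapping.single (Poly_Mapping.update a b f) 1 = Poly_Mapping.single f 1 * (zvar a ^ b :: 'v zpoly)"
      by (simp add: pow_eq mult_single)
    then show ?case using mult[OF update(3) pow] by simp
  qed
  have "of_int c = (Poly_Mapping.single 0 c :: 'v zpoly)" for c
    by (metis single_of_int of_int_eq_id id_apply)
  then have "Poly_Mapping.single m c = (of_int c * Poly_Mapping.single m 1 :: 'v zpoly)" for m c
    by (simp only: mult_single add_0 mult_1_right)
  then have "Q (Poly_Mapping.single m c)" for m c using mult[OF int mon] by metis
  then show ?thesis by (induction P rule: zpoly_induct_single) (simp_all add: zero add)
qed

context cring
begin

context
  fixes \<rho> :: "'v \<Rightarrow> 'a"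
  assumes \<rho>: "range \<rho> \<subseteq> carrier R"
begin

private definition mon :: "('v \<Rightarrow>\<^sub>0 nat) \<Rightarrow> 'a" where
  "mon m = (\<Otimes>v\<in>Poly_Mapping.keys m. \<rho> v [^] Poly_Mapping.lookup m v)"

private lemma rho_closed [simp]: "\<rho> v \<in> carrier R"
  using \<rho> by auto

private lemma mon_closed [simp]: "mon m \<in> carrier R"
  by (simp add: mon_def)

private lemma mon_superset:
  "finite K \<Longrightarrow> Poly_Mapping.keys m \<subseteq> K \<Longrightarrow> mon m = (\<Otimes>v\<in>K. \<rho> v [^] Poly_Mapping.lookup m v)"
  unfolding mon_def by (rule finprod_mono_neutral_cong_left) (auto simp: in_keys_iff)

private lemma mon_add: "mon (m + n) = mon m \<otimes> mon n"
proof -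
  let ?K = "Poly_Mapping.keys m \<union> Poly_Mapping.keys n"
  have "mon (m + n) = (\<Otimes>v\<in>?K. \<rho> v [^] Poly_Mapping.lookup (m + n) v)"
    by (rule mon_superset) (simp_all add: keys_add)
  also have "\<dots> = (\<Otimes>v\<in>?K. \<rho> v [^] Poly_Mapping.lookup m v \<otimes> \<rho> v [^] Poly_Mapping.lookup n v)"
    by (intro finprod_cong) (auto simp: lookup_add nat_pow_mult)
  also have "\<dots> = mon m \<otimes> mon n"
    by (simp add: finprod_multf mon_superset[of ?K])
  finally show ?thesis .
qed

text \<open>Coefficients may cancel in a sum, so supports do not simply combine; a larger finite
  index set makes two polynomials comparable term by term.\<close>

private lemma eval_superset:
  "finite K \<Longrightarrow> Poly_Mapping.keys P \<subseteq> K \<Longrightarrow>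
    zpoly_eval R \<rho> P = (\<Oplus>m\<in>K. [Poly_Mapping.lookup P m] \<cdot> mon m)"
  unfolding zpoly_eval_def mon_def[symmetric]
  by (rule add.finprod_mono_neutral_cong_left) (auto simp: in_keys_iff add_pow_int_ge)

lemma zpoly_eval_closed [simp]: "zpoly_eval R \<rho> P \<in> carrier R"
  unfolding zpoly_eval_def mon_def[symmetric] by (simp add: Pi_def)

lemma zpoly_eval_add: "zpoly_eval R \<rho> (P + Q) = zpoly_eval R \<rho> P \<oplus> zpoly_eval R \<rho> Q"
proof -
  let ?K = "Poly_Mapping.keys P \<union> Poly_Mapping.keys Q"
  have "zpoly_eval R \<rho> (P + Q) = (\<Oplus>m\<in>?K. [Poly_Mapping.lookup (P + Q) m] \<cdot> mon m)"
    by (rule eval_superset) (simp_all add: keys_add)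
  also have "\<dots> = (\<Oplus>m\<in>?K. [Poly_Mapping.lookup P m] \<cdot> mon m \<oplus> [Poly_Mapping.lookup Q m] \<cdot> mon m)"
    by (intro finsum_cong) (auto simp: lookup_add add.int_pow_mult simp_implies_def)
  also have "\<dots> = zpoly_eval R \<rho> P \<oplus> zpoly_eval R \<rho> Q"
    by (simp add: finsum_addf eval_superset[of ?K])
  finally show ?thesis .
qed

private lemma eval_single: "zpoly_eval R \<rho> (Poly_Mapping.single m c) = [c] \<cdot> mon m"
  by (subst eval_superset[of "{m}"]) auto

lemma zpoly_eval_0 [simp]: "zpoly_eval R \<rho> 0 = \<zero>"
  by (simp add: zpoly_eval_def)

lemma zpoly_eval_1 [simp]: "zpoly_eval R \<rho> 1 = \<one>"
  using eval_single[of 0 1] by (simp add: mon_def)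

lemma zpoly_eval_zvar [simp]: "zpoly_eval R \<rho> (zvar v) = \<rho> v"
  using eval_single[of "Poly_Mapping.single v 1" 1] by (simp add: mon_def zvar_def)

lemma zpoly_eval_mult: "zpoly_eval R \<rho> (P * Q) = zpoly_eval R \<rho> P \<otimes> zpoly_eval R \<rho> Q"
proof (induction P rule: zpoly_induct_single)
  case (add P m c)
  have "zpoly_eval R \<rho> (Poly_Mapping.single m c * Q) = [c] \<cdot> mon m \<otimes> zpoly_eval R \<rho> Q"
  proof (induction Q rule: zpoly_induct_single)
    case (add Q n d)
    have "[(c * d)] \<cdot> (mon m \<otimes> mon n) = [c] \<cdot> mon m \<otimes> [d] \<cdot> mon n"
      by (simp add: add_pow_ldistr_int add_pow_rdistr_int add.int_pow_pow mult.commute)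
    then show ?case using add
      by (simp add: distrib_left zpoly_eval_add mult_single eval_single mon_add r_distr)
  qed simp
  then show ?case using add by (simp add: distrib_right zpoly_eval_add eval_single l_distr)
qed simp

lemma zpoly_eval_ring_hom: "zpoly_eval R \<rho> \<in> ring_hom type_ring R"
  by (rule ring_hom_memI) (simp_all add: zpoly_eval_add zpoly_eval_mult)

lemma zpoly_eval_ring_hom_cring: "ring_hom_cring type_ring R (zpoly_eval R \<rho>)"
  by (intro ring_hom_cring.intro ring_hom_cring_axioms.intro zpoly_eval_ring_hom is_cring cring_type_ring)

lemma zpoly_eval_uminus: "zpoly_eval R \<rho> (- P) = \<ominus> zpoly_eval R \<rho> P"
proof -
  have "zpoly_eval R \<rho> (- P) \<oplus> zpoly_eval R \<rho> P = \<zero>"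
    by (simp flip: zpoly_eval_add)
  then show ?thesis by (intro minus_equality[symmetric]) auto
qed

text \<open>Serves to keep the unspecified cofactors of binomial expansions inside the subring of
  sums of Teichmueller lifts.\<close>

lemma zpoly_eval_in_subring:
  assumes "subring H R" and "range \<rho> \<subseteq> H"
  shows "zpoly_eval R \<rho> P \<in> H"
  using assms
  by (induction P rule: zpoly_induct)
    (auto simp: zpoly_eval_add zpoly_eval_mult zpoly_eval_uminus intro: subringE[OF assms(1)])

lemma zpoly_eval_of_nat_mult: "zpoly_eval R \<rho> (of_nat k * P) = [k] \<cdot> zpoly_eval R \<rho> P"
  by (induction k) (simp_all add: distrib_right zpoly_eval_add a_comm)

lemma zpoly_eval_power: "zpoly_eval R \<rho> (P ^ k) = zpoly_eval R \<rho> P [^] k"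
  by (induction k) (simp_all add: zpoly_eval_mult m_comm)

end

end

lemma (in ring_hom_cring) hom_zpoly_eval:
  assumes "range \<rho> \<subseteq> carrier R"
  shows "h (zpoly_eval R \<rho> P) = zpoly_eval S (h \<circ> \<rho>) P"
proof -
  have "range (\<lambda>v. h (\<rho> v)) \<subseteq> carrier S" using assms by auto
  note S_eval = S.zpoly_eval_add[OF this] S.zpoly_eval_mult[OF this] S.zpoly_eval_uminus[OF this]
    S.zpoly_eval_1[OF this] S.zpoly_eval_zvar[OF this]
  show ?thesis unfolding comp_def
    by (induction P rule: zpoly_induct)
      (use assms in \<open>auto simp: R.zpoly_eval_add R.zpoly_eval_mult R.zpoly_eval_uminus S_eval\<close>)
qed

section \<open>Powers with exponent p and congruences modulo powers of p\<close>

lemma comm_ring_prime_binomial_expansion: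
  fixes a b :: "'r::comm_ring_1"
  assumes "Factorial_Ring.prime p"
  obtains c where "(a + b) ^ p = a ^ p + of_nat p * a ^ (p - 1) * b + of_nat p * (b\<^sup>2 * c) + b ^ p"
proof -
  define t where "t k = of_nat (p choose k) * b ^ k * a ^ (p - k)" for k
  define c where "c = (\<Sum>k\<in>{2..<p}. of_nat ((p choose k) div p) * b ^ (k - 2) * a ^ (p - k))"
  have "p \<ge> 2" using assms by (rule prime_ge_2_nat)
  \<comment> \<open>The terms k = 0, 1, p stay explicit and all others contain b^2; for p = 2 the
    remaining range is empty.\<close>
  then have "{..p} = insert 0 (insert 1 (insert p {2..<p}))" by auto
  then have "(a + b) ^ p = (\<Sum>k\<in>insert 0 (insert 1 (insert p {2..<p})). t k)"
    by (simp add: binomial_ring[of b a p] add.commute[of a b] t_def)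
  also have "\<dots> = t 0 + t 1 + t p + (\<Sum>k\<in>{2..<p}. t k)"
    using \<open>p \<ge> 2\<close> by simp
  also have "(\<Sum>k\<in>{2..<p}. t k) = of_nat p * (b\<^sup>2 * c)"
    unfolding c_def sum_distrib_left
  proof (rule sum.cong)
    fix k assume k: "k \<in> {2..<p}"
    then have "p dvd (p choose k)" using assms by (intro dvd_choose_prime) auto
    then have "(of_nat (p choose k) :: 'r) = of_nat p * of_nat ((p choose k) div p)"
      by (simp flip: of_nat_mult)
    moreover have "b ^ k = b\<^sup>2 * b ^ (k - 2)" using k by (metis atLeastLessThan_iff le_add_diff_inverse power_add)
    ultimately show "t k = of_nat p * (b\<^sup>2 * (of_nat ((p choose k) div p) * b ^ (k - 2) * a ^ (p - k)))"
      by (simp add: t_def algebra_simps)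
  qed simp
  finally show thesis by (intro that[of c]) (simp add: t_def algebra_simps)
qed

text \<open>Each p-th power gains one factor p: u^p - v^p is (u - v) times a sum of p terms, all
  congruent to v^(p-1) modulo p because p divides u - v.\<close>

lemma power_dvd_diff_power:
  fixes x y :: "'r::comm_ring_1"
  assumes "of_nat p ^ k dvd x - y" "k \<ge> 1"
  shows "of_nat p ^ (k + j) dvd x ^ (p ^ j) - y ^ (p ^ j)"
proof (induction j)
  case (Suc j)
  define u v where "u = x ^ p ^ j" and "v = y ^ p ^ j"
  have "of_nat p dvd u - v"
    using Suc assms(2) unfolding u_def v_def by (meson dvd_power dvd_trans trans_le_add1 zero_less_one less_le_trans)
  moreover have "u - v dvd u ^ i - v ^ i" for i by (metis dvd_def power_diff_sumr2)
  ultimately have "of_nat p dvd v ^ (p - Suc i) * u ^ i - v ^ (p - Suc i) * v ^ i" for i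
    by (metis dvd_mult dvd_trans right_diff_distrib)
  then have "of_nat p dvd (\<Sum>i<p. v ^ (p - Suc i) * u ^ i - v ^ (p - Suc i) * v ^ i)"
    by (intro dvd_sum) simp
  moreover have "(\<Sum>i<p. v ^ (p - Suc i) * v ^ i) = of_nat p * v ^ (p - 1)"
    by (simp flip: power_add)
  ultimately have "of_nat p dvd (\<Sum>i<p. v ^ (p - Suc i) * u ^ i)"
    by (metis dvd_triv_left sum_subtractf dvd_add diff_add_cancel)
  moreover have "of_nat p ^ (k + j) dvd u - v" using Suc by (simp add: u_def v_def)
  ultimately have "of_nat p ^ (k + j) * of_nat p dvd u ^ p - v ^ p"
    by (simp add: power_diff_sumr2[of u p v] mult_dvd_mono)
  then show ?case by (simp add: u_def v_def mult.commute flip: power_mult)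
qed (use assms in simp)

section \<open>Ghost components\<close>

lemma witt_poly_0 [simp]: "witt_poly p 0 u = u 0"
  by (simp add: witt_poly_def)

text \<open>Splitting off the last component relates consecutive ghost components through p-th
  powers, the source of all congruences below. Its counterpart \<open>witt_poly_Suc_shift\<close>
  splits off the first component, which suits Teichmueller lifts and V.\<close>

lemma witt_poly_Suc:
  "witt_poly p (Suc n) u = witt_poly p n (\<lambda>i. u i ^ p) + of_nat p ^ Suc n * u (Suc n)"
  by (simp add: witt_poly_def Suc_diff_le flip: power_mult)

lemma witt_poly_Suc_shift:
  "witt_poly p (Suc n) u = u 0 ^ p ^ Suc n + of_nat p * witt_poly p n (\<lambda>i. u (Suc i))"
  by (simp add: witt_poly_def sum.atMost_Suc_shift sum_distrib_left mult.assoc del: sum.atMost_Suc)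

lemma witt_poly_hom:
  assumes "\<And>a b. h (a + b) = h a + h b" "\<And>a b. h (a * b) = h a * h b" "h 1 = 1" "h 0 = 0"
  shows "h (witt_poly p n u) = witt_poly p n (\<lambda>i. h (u i))"
proof -
  have pow: "h (a ^ k) = h a ^ k" for a k by (induction k) (simp_all add: assms)
  have nat: "h (of_nat k) = of_nat k" for k by (induction k) (simp_all add: assms)
  have "h (sum f {..k::nat}) = (\<Sum>i\<le>k. h (f i))" for f k by (induction k) (simp_all add: assms)
  then show ?thesis by (simp add: witt_poly_def assms pow nat)
qed

text \<open>In the i-th term the power p^(n-i) gains n - i factors p and the coefficient p^i
  supplies the other i, so all terms reach the same precision.\<close>

lemma witt_poly_cong_power:
  assumes "\<And>i. i \<le> n \<Longrightarrow> of_nat p ^ k dvd u i - w i" "k \<ge> 1"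
  shows "of_nat p ^ (k + n) dvd witt_poly p n u - witt_poly p n w"
proof -
  have "of_nat p ^ (k + n) dvd of_nat p ^ i * u i ^ p ^ (n - i) - of_nat p ^ i * w i ^ p ^ (n - i)"
    if "i \<le> n" for i
  proof -
    have "of_nat p ^ i * of_nat p ^ (k + (n - i)) dvd of_nat p ^ i * (u i ^ p ^ (n - i) - w i ^ p ^ (n - i))"
      using assms that by (intro mult_dvd_mono power_dvd_diff_power) auto
    then show ?thesis using that by (simp add: right_diff_distrib flip: power_add)
  qed
  then show ?thesis unfolding witt_poly_def sum_subtractf[symmetric] by (intro dvd_sum) auto
qed

lemma zpoly_of_nat_mult_cancel:
  fixes P Q :: "'v zpoly"
  assumes "k > 0" "of_nat k * P = of_nat k * Q"
  shows "P = Q"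
proof -
  have "Poly_Mapping.lookup (of_nat k * P) m = int k * Poly_Mapping.lookup P m" for k m and P :: "'v zpoly"
    by (induction k) (simp_all add: lookup_add algebra_simps)
  then show ?thesis using assms by (intro poly_mapping_eqI) (metis mult_cancel_left of_nat_0_less_iff less_numeral_extra(3))
qed

lemma zpoly_of_nat_power_mult_cancel:
  fixes P Q :: "'v zpoly"
  assumes "k > 0" "of_nat k ^ j * P = of_nat k ^ j * Q"
  shows "P = Q"
  using zpoly_of_nat_mult_cancel[of "k ^ j" P Q] assms by simp

text \<open>Integer polynomials have no p-torsion, so each component can be recovered from its ghost
  component once the earlier ones are known.\<close>

lemma witt_poly_inj:
  fixes u w :: "nat \<Rightarrow> 'v zpoly"
  assumes "p > 0" "\<And>m. m \<le> n \<Longrightarrow> witt_poly p m u = witt_poly p m w"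
  shows "u n = w n"
  using assms(2)
proof (induction n rule: less_induct)
  case (less n)
  show ?case
  proof (cases n)
    case (Suc m)
    have "witt_poly p m (\<lambda>i. u i ^ p) = witt_poly p m (\<lambda>i. w i ^ p)"
      unfolding witt_poly_def using less Suc by (intro sum.cong) auto
    then have "of_nat p ^ Suc m * u (Suc m) = of_nat p ^ Suc m * w (Suc m)"
      using less(2)[of n] by (simp add: Suc witt_poly_Suc)
    then show ?thesis using assms(1) Suc zpoly_of_nat_power_mult_cancel by metis
  qed (use less(2)[of 0] in simp)
qed

text \<open>Congruence version of ghost injectivity, made for projection to a ring with p = 0. If
  the earlier components agree modulo p, their p-th powers agree modulo p^2 and change the n-th
  ghost component by a multiple of p^(n+1) only; so p^(n+1) divides p^n (u_n - w_n).\<close>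

lemma witt_poly_dvd_imp_dvd:
  fixes u w :: "nat \<Rightarrow> 'v zpoly"
  assumes "p > 0" "\<And>n. of_nat p ^ Suc n dvd witt_poly p n u - witt_poly p n w"
  shows "of_nat p dvd u n - w n"
proof (induction n rule: less_induct)
  case (less n)
  show ?case
  proof (cases n)
    case (Suc m)
    have "of_nat p ^ 2 dvd u i ^ p - w i ^ p" if "i \<le> m" for i
      using power_dvd_diff_power[of p 1 "u i" "w i" 1] less[of i] that Suc by (simp add: numeral_2_eq_2)
    then have "of_nat p ^ (2 + m) dvd witt_poly p m (\<lambda>i. u i ^ p) - witt_poly p m (\<lambda>i. w i ^ p)"
      by (intro witt_poly_cong_power) auto
    moreover have "of_nat p ^ (2 + m) dvd (witt_poly p m (\<lambda>i. u i ^ p) - witt_poly p m (\<lambda>i. w i ^ p))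
        + of_nat p ^ Suc m * (u n - w n)"
      using assms(2)[of n] Suc by (simp add: witt_poly_Suc algebra_simps)
    ultimately have "of_nat p ^ (2 + m) dvd of_nat p ^ Suc m * (u n - w n)"
      by (simp add: dvd_add_right_iff)
    then obtain c where "of_nat p ^ Suc m * (u n - w n) = of_nat p ^ (2 + m) * c" by (rule dvdE)
    then have "of_nat p ^ Suc m * (u n - w n) = of_nat p ^ Suc m * (of_nat p * c)"
      by (simp add: mult_ac)
    then show ?thesis using zpoly_of_nat_power_mult_cancel[OF assms(1)] by (metis dvd_triv_left)
  qed (use assms(2)[of 0] in simp)
qed

section \<open>The Frobenius lift on integer polynomials and Dwork's criterion\<close>

lemma range_type_ring [simp]: "range \<rho> \<subseteq> carrier (type_ring :: 'a::comm_ring_1 ring)"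
  by simp

lemmas teval_add = cring.zpoly_eval_add[OF cring_type_ring range_type_ring, unfolded type_ring_simps]
lemmas teval_mult = cring.zpoly_eval_mult[OF cring_type_ring range_type_ring, unfolded type_ring_simps]
lemmas teval_0 [simp] = cring.zpoly_eval_0[OF cring_type_ring range_type_ring, unfolded type_ring_simps]
lemmas teval_1 [simp] = cring.zpoly_eval_1[OF cring_type_ring range_type_ring, unfolded type_ring_simps]
lemmas teval_zvar [simp] = cring.zpoly_eval_zvar[OF cring_type_ring range_type_ring]

lemma teval_uminus: "zpoly_eval type_ring \<rho> (- P) = - zpoly_eval type_ring \<rho> P"
  by (metis teval_add teval_0 add.right_inverse add_eq_0_iff)

lemma teval_witt_poly:
  "zpoly_eval type_ring \<rho> (witt_poly p n u) = witt_poly p n (\<lambda>i. zpoly_eval type_ring \<rho> (u i))"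
  by (rule witt_poly_hom) (simp_all add: teval_add teval_mult)

text \<open>The substitution v -> v^p: a ring endomorphism that reduces to the Frobenius modulo p,
  as Dwork's criterion requires.\<close>

definition frob_lift :: "nat \<Rightarrow> 'v zpoly \<Rightarrow> 'v zpoly" where
  "frob_lift p = zpoly_eval type_ring (\<lambda>v. zvar v ^ p)"

lemma frob_lift_cong:
  assumes "Factorial_Ring.prime p"
  shows "of_nat p dvd P ^ p - frob_lift p P"
  unfolding frob_lift_def
proof (induction P rule: zpoly_induct)
  case (add a b)
  obtain c where "(a + b) ^ p = a ^ p + of_nat p * a ^ (p - 1) * b + of_nat p * (b\<^sup>2 * c) + b ^ p"
    using assms by (rule comm_ring_prime_binomial_expansion)
  then have "(a + b) ^ p - (a ^ p + b ^ p) = of_nat p * (a ^ (p - 1) * b + b\<^sup>2 * c)"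
    by (simp add: algebra_simps)
  then have "of_nat p dvd (a + b) ^ p - (a ^ p + b ^ p)" by simp
  from dvd_add[OF this dvd_add[OF add]] show ?case by (simp add: teval_add algebra_simps)
next
  case (neg a)
  \<comment> \<open>Expanding (a - a)^p = 0 treats p = 2, where (-a)^p is not -a^p, together with
    the odd primes.\<close>
  obtain c where "(a + - a) ^ p = a ^ p + of_nat p * a ^ (p - 1) * - a + of_nat p * ((- a)\<^sup>2 * c) + (- a) ^ p"
    using assms by (rule comm_ring_prime_binomial_expansion)
  moreover have "(a + - a) ^ p = 0" using prime_gt_0_nat[OF assms] by (simp add: zero_power)
  ultimately have "a ^ p + (- a) ^ p = of_nat p * (a ^ (p - 1) * a - (- a)\<^sup>2 * c)"
    by (simp add: algebra_simps eq_neg_iff_add_eq_0 add_eq_0_iff)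
  then have "of_nat p dvd a ^ p + (- a) ^ p" by simp
  from dvd_diff[OF this neg] show ?case by (simp add: teval_uminus algebra_simps)
next
  case (mult a b)
  have "(a * b) ^ p - zpoly_eval type_ring (\<lambda>v. zvar v ^ p) (a * b) =
      (a ^ p - zpoly_eval type_ring (\<lambda>v. zvar v ^ p) a) * b ^ p +
      (b ^ p - zpoly_eval type_ring (\<lambda>v. zvar v ^ p) b) * zpoly_eval type_ring (\<lambda>v. zvar v ^ p) a"
    by (simp add: teval_mult algebra_simps)
  then show ?case using mult by simp
qed simp_all

text \<open>Up to its last term, the (n+1)-st ghost component is the n-th one of the p-th powers.
  These agree with the Frobenius lifts modulo p, and the ghost polynomial gains n more factors
  p.\<close>

lemma frob_lift_witt_poly: 
  assumes "Factorial_Ring.prime p"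
  shows "of_nat p ^ Suc n dvd witt_poly p (Suc n) u - frob_lift p (witt_poly p n u)"
proof -
  have "of_nat p ^ (1 + n) dvd witt_poly p n (\<lambda>i. u i ^ p) - witt_poly p n (\<lambda>i. frob_lift p (u i))"
    by (rule witt_poly_cong_power) (simp_all add: frob_lift_cong[OF assms])
  from dvd_add[OF this dvd_triv_left[of _ "u (Suc n)"]] show ?thesis
    by (simp add: witt_poly_Suc teval_witt_poly frob_lift_def algebra_simps)
qed

text \<open>Dwork's criterion. The components are found one at a time: compatibility with the
  Frobenius lift makes the remaining discrepancy divisible by p^(n+1), which is exactly the
  coefficient of the new component.\<close>

lemma dwork_lemma:
  fixes g :: "nat \<Rightarrow> 'v zpoly"
  assumes p: "Factorial_Ring.prime p"
    and g: "\<And>n. of_nat p ^ Suc n dvd g (Suc n) - frob_lift p (g n)"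
  shows "\<exists>u. \<forall>n. witt_poly p n u = g n"
proof -
  have p0: "p > 0" using p by (rule prime_gt_0_nat)
  have "\<exists>u. \<forall>m\<le>n. witt_poly p m u = g m" for n
  proof (induction n)
    case 0
    show ?case by (rule exI[of _ "\<lambda>_. g 0"]) simp
  next
    case (Suc n)
    then obtain u where u: "\<And>m. m \<le> n \<Longrightarrow> witt_poly p m u = g m" by blast
    have "of_nat p ^ Suc n dvd (g (Suc n) - frob_lift p (g n))
        - (witt_poly p (Suc n) u - frob_lift p (witt_poly p n u))"
      by (intro dvd_diff g frob_lift_witt_poly p)
    then have "of_nat p ^ Suc n dvd g (Suc n) - witt_poly p (Suc n) u"
      using u[of n] by simp
    then obtain c where c: "g (Suc n) - witt_poly p (Suc n) u = of_nat p ^ Suc n * c" by (rule dvdE)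
    define w where "w = u(Suc n := u (Suc n) + c)"
    have "witt_poly p n (\<lambda>i. w i ^ p) = witt_poly p n (\<lambda>i. u i ^ p)"
      unfolding witt_poly_def by (intro sum.cong) (auto simp: w_def)
    then have "witt_poly p (Suc n) w = witt_poly p (Suc n) u + of_nat p ^ Suc n * c"
      by (simp add: witt_poly_Suc) (simp add: w_def algebra_simps)
    then have "witt_poly p (Suc n) w = g (Suc n)"
      using c by (metis add_diff_cancel_left' diff_add_cancel add.commute)
    moreover have "witt_poly p m w = witt_poly p m u" if "m \<le> n" for m
      unfolding witt_poly_def using that by (intro sum.cong) (auto simp: w_def)
    ultimately show ?case using u by (intro exI[of _ w]) (auto simp: le_Suc_eq)
  qed
  then obtain u where u: "\<And>n m. m \<le> n \<Longrightarrow> witt_poly p m (u n) = g m" by metis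
  \<comment> \<open>The solutions up to different n were chosen independently; ghost injectivity
    makes them agree where both apply, so the diagonal solves all equations at once.\<close>
  have "u n m = u m m" if "m \<le> n" for m n
    by (rule witt_poly_inj[OF p0]) (use u that in auto)
  then have "\<And>i. i \<le> n \<Longrightarrow> u i i = u n i" for n by metis
  then have "witt_poly p n (\<lambda>i. u i i) = witt_poly p n (u n)" for n
    unfolding witt_poly_def by (intro sum.cong) (simp_all only: atMost_iff)
  then show ?thesis using u by (intro exI[of _ "\<lambda>i. u i i"]) simp
qed

text \<open>Resolves the definite description. Respecting congruences and commuting with the
  Frobenius lift are what Dwork's criterion needs of \<open>star\<close>; uniqueness is ghost
  injectivity.\<close>

lemma witt_poly_structure:
  assumes p: "Factorial_Ring.prime p"
    and cong: "\<And>d a b a' b' :: (nat + nat) zpoly.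
      d dvd a - a' \<Longrightarrow> d dvd b - b' \<Longrightarrow> d dvd star a b - star a' b'"
    and hom: "\<And>a b. frob_lift p (star a b) = star (frob_lift p a) (frob_lift p b)"
  shows "witt_poly p n (witt_structure_poly p star) =
    star (witt_poly p n (\<lambda>i. zvar (Inl i))) (witt_poly p n (\<lambda>i. zvar (Inr i)))"
proof -
  have "\<exists>S. \<forall>n. witt_poly p n S =
      star (witt_poly p n (\<lambda>i. zvar (Inl i))) (witt_poly p n (\<lambda>i. zvar (Inr i)))"
    using p by (rule dwork_lemma) (unfold hom, intro cong frob_lift_witt_poly p)
  moreover have "S = S'" if "\<forall>n. witt_poly p n S = g n" "\<forall>n. witt_poly p n S' = g n"
    for S S' :: "nat \<Rightarrow> (nat + nat) zpoly" and g
    using witt_poly_inj[OF prime_gt_0_nat[OF p]] that by (metis ext)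
  ultimately have "\<exists>!S. \<forall>n. witt_poly p n S =
      star (witt_poly p n (\<lambda>i. zvar (Inl i))) (witt_poly p n (\<lambda>i. zvar (Inr i)))"
    by (rule ex_ex1I)
  from theI'[OF this] show ?thesis unfolding witt_structure_poly_def by blast
qed

lemma witt_poly_add_structure:
  assumes "Factorial_Ring.prime p"
  shows "witt_poly p n (\<lambda>i. zpoly_eval type_ring (case_sum a b) (witt_structure_poly p (+) i)) =
    witt_poly p n a + witt_poly p n b"
proof -
  have "witt_poly p n (witt_structure_poly p (+)) =
      witt_poly p n (\<lambda>i. zvar (Inl i)) + witt_poly p n (\<lambda>i. zvar (Inr i))"
  proof (rule witt_poly_structure[OF assms])
    fix d a b a' b' :: "(nat + nat) zpoly"
    assume "d dvd a - a'" "d dvd b - b'"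
    from dvd_add[OF this] show "d dvd a + b - (a' + b')" by (simp add: algebra_simps)
  qed (simp add: frob_lift_def teval_add)
  from arg_cong[OF this, of "zpoly_eval type_ring (case_sum a b)"]
  show ?thesis by (simp add: teval_add teval_witt_poly)
qed

lemma witt_poly_mult_structure:
  assumes "Factorial_Ring.prime p"
  shows "witt_poly p n (\<lambda>i. zpoly_eval type_ring (case_sum a b) (witt_structure_poly p (*) i)) =
    witt_poly p n a * witt_poly p n b"
proof -
  have "witt_poly p n (witt_structure_poly p (*)) =
      witt_poly p n (\<lambda>i. zvar (Inl i)) * witt_poly p n (\<lambda>i. zvar (Inr i))"
  proof (rule witt_poly_structure[OF assms])
    fix d a b a' b' :: "(nat + nat) zpoly"
    assume "d dvd a - a'" "d dvd b - b'"
    then have "d dvd (a - a') * b + (b - b') * a'" by simp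
    then show "d dvd a * b - a' * b'" by (simp add: algebra_simps)
  qed (simp add: frob_lift_def teval_mult)
  from arg_cong[OF this, of "zpoly_eval type_ring (case_sum a b)"]
  show ?thesis by (simp add: teval_mult teval_witt_poly)
qed

section \<open>Witt vectors in characteristic \<open>p\<close>\<close>

lemma teich_type_ring [simp]:
  "teich type_ring a 0 = a" "teich type_ring a (Suc n) = (0 :: 'a::comm_ring_1)"
  and versch_type_ring [simp]:
  "versch type_ring u 0 = (0 :: 'a)" "versch type_ring u (Suc n) = u n"
  by (simp_all add: teich_def versch_def)

lemma witt_poly_zero [simp]: "p > 0 \<Longrightarrow> witt_poly p n (\<lambda>_. 0) = 0"
  by (simp add: witt_poly_def zero_power)

lemma witt_poly_teich: "p > 0 \<Longrightarrow> witt_poly p n (teich type_ring a) = a ^ p ^ n"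
  by (cases n) (simp_all add: witt_poly_Suc_shift)

lemma witt_poly_versch_Suc:
  "p > 0 \<Longrightarrow> witt_poly p (Suc n) (versch type_ring u) = of_nat p * witt_poly p n u"
  by (simp add: witt_poly_Suc_shift zero_power)

text \<open>In characteristic p the Witt vector Frobenius is the p-th power on components; in
  general the two agree only modulo p.\<close>

definition witt_frob :: "('a, 'b) ring_scheme \<Rightarrow> nat \<Rightarrow> (nat \<Rightarrow> 'a) \<Rightarrow> nat \<Rightarrow> 'a" where
  "witt_frob R p w = (\<lambda>n. w n [^]\<^bsub>R\<^esub> p)"

locale witt_char_p = cring R for R (structure) and p :: nat +
  assumes prime_p: "Factorial_Ring.prime p"
    and char_p: "[p] \<cdot> \<one> = \<zero>"
begin

abbreviation W where "W \<equiv> witt_ring R p"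
abbreviation F where "F \<equiv> witt_frob R p"
abbreviation V where "V \<equiv> versch R"
abbreviation T where "T \<equiv> teich R"

lemma p_pos: "p > 0"
  using prime_p by (rule prime_gt_0_nat)

lemma p_mult_eq_zero: "a \<in> carrier R \<Longrightarrow> [p] \<cdot> a = \<zero>"
  using add_pow_ldistr[of \<one> a p] char_p by simp

text \<open>With variables indexed by \<open>R\<close> itself, evaluation is surjective, so an identity in \<open>W(R)\<close> can be
  checked on ghost components over a \<open>p\<close>-torsion-free polynomial ring. As \<open>p = 0\<close> in \<open>R\<close>, it
  suffices that the \<open>n\<close>-th ghost components agree modulo \<open>p\<^bsup>n+1\<^esup>\<close>.\<close>

definition proj :: "'a zpoly \<Rightarrow> 'a" where
  "proj = zpoly_eval R (\<lambda>v. if v \<in> carrier R then v else \<zero>)"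

lemma proj_range: "range (\<lambda>v. if v \<in> carrier R then v else \<zero>) \<subseteq> carrier R"
  by auto

lemma proj_closed [simp]: "proj P \<in> carrier R"
  unfolding proj_def by (rule zpoly_eval_closed[OF proj_range])

lemma proj_hom: "ring_hom_cring type_ring R proj"
  unfolding proj_def by (rule zpoly_eval_ring_hom_cring[OF proj_range])

lemma proj_add: "proj (P + Q) = proj P \<oplus> proj Q"
  and proj_mult: "proj (P * Q) = proj P \<otimes> proj Q"
  and proj_0 [simp]: "proj 0 = \<zero>"
  and proj_1 [simp]: "proj 1 = \<one>"
  and proj_power: "proj (P ^ k) = proj P [^] k"
  unfolding proj_def
  by (simp_all add: zpoly_eval_add[OF proj_range] zpoly_eval_mult[OF proj_range]
      zpoly_eval_power[OF proj_range] zpoly_eval_0[OF proj_range] zpoly_eval_1[OF proj_range])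

lemma proj_dvd_eq:
  assumes "of_nat p dvd P - Q"
  shows "proj P = proj Q"
proof -
  from assms obtain c where "P = Q + of_nat p * c" by (metis dvdE diff_add_cancel add.commute)
  moreover have "proj (of_nat p * c) = \<zero>"
    unfolding proj_def zpoly_eval_of_nat_mult[OF proj_range]
    by (simp add: p_mult_eq_zero zpoly_eval_closed[OF proj_range])
  ultimately show ?thesis by (simp add: proj_add)
qed

abbreviation wproj :: "(nat \<Rightarrow> 'a zpoly) \<Rightarrow> nat \<Rightarrow> 'a" where
  "wproj u \<equiv> \<lambda>n. proj (u n)"

lemma wproj_eqI:
  assumes "\<And>n. of_nat p ^ Suc n dvd witt_poly p n u - witt_poly p n v"
  shows "wproj u = wproj v"
  using witt_poly_dvd_imp_dvd[OF p_pos assms] by (intro ext proj_dvd_eq)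

lemma wproj_eqI': "(\<And>n. witt_poly p n u = witt_poly p n v) \<Longrightarrow> wproj u = wproj v"
  by (rule wproj_eqI) simp

lemma witt_carrier: "carrier W = UNIV \<rightarrow> carrier R"
  and witt_zero: "\<zero>\<^bsub>W\<^esub> = (\<lambda>_. \<zero>)"
  and witt_one: "\<one>\<^bsub>W\<^esub> = T \<one>"
  by (simp_all add: witt_ring_def)

lemma witt_component [simp]: "w \<in> carrier W \<Longrightarrow> w n \<in> carrier R"
  by (auto simp: witt_carrier)

lemma wproj_closed [simp]: "wproj u \<in> carrier W"
  by (simp add: witt_carrier)

lemma ex_wproj:
  assumes "w \<in> carrier W"
  obtains u where "w = wproj u"
  using assms by (intro that[of "\<lambda>n. zvar (w n)"] ext)
    (simp add: proj_def zpoly_eval_zvar[OF proj_range])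

lemma wproj_zero: "wproj (\<lambda>_. 0) = \<zero>\<^bsub>W\<^esub>"
  by (simp add: witt_zero)

lemma wproj_teich: "wproj (teich type_ring a) = T (proj a)"
  by (auto simp: teich_def split: nat.split)

lemma wproj_one: "wproj (teich type_ring 1) = \<one>\<^bsub>W\<^esub>"
  by (simp add: wproj_teich witt_one)

lemma wproj_versch: "wproj (versch type_ring u) = V (wproj u)"
  by (auto simp: versch_def split: nat.split)

lemma wproj_frob: "wproj (\<lambda>n. u n ^ p) = F (wproj u)"
  by (simp add: witt_frob_def proj_power)

section \<open>The ring structure of W(R)\<close>

definition zadd :: "(nat \<Rightarrow> 'v zpoly) \<Rightarrow> (nat \<Rightarrow> 'v zpoly) \<Rightarrow> nat \<Rightarrow> 'v zpoly" where
  "zadd u v = (\<lambda>n. zpoly_eval type_ring (case_sum u v) (witt_structure_poly p (+) n))"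

definition zmult :: "(nat \<Rightarrow> 'v zpoly) \<Rightarrow> (nat \<Rightarrow> 'v zpoly) \<Rightarrow> nat \<Rightarrow> 'v zpoly" where
  "zmult u v = (\<lambda>n. zpoly_eval type_ring (case_sum u v) (witt_structure_poly p (*) n))"

lemma witt_poly_zadd [simp]: "witt_poly p n (zadd u v) = witt_poly p n u + witt_poly p n v"
  unfolding zadd_def by (rule witt_poly_add_structure[OF prime_p])

lemma witt_poly_zmult [simp]: "witt_poly p n (zmult u v) = witt_poly p n u * witt_poly p n v"
  unfolding zmult_def by (rule witt_poly_mult_structure[OF prime_p])

lemma zadd_0 [simp]: "zadd u v 0 = u 0 + v 0"
  and zmult_0 [simp]: "zmult u v 0 = u 0 * v 0"
  using witt_poly_zadd[of 0 u v] witt_poly_zmult[of 0 u v] by simp_all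

lemma proj_zpoly_eval: "proj (zpoly_eval type_ring \<rho> P) = zpoly_eval R (\<lambda>v. proj (\<rho> v)) P"
proof -
  interpret h: ring_hom_cring type_ring R proj by (rule proj_hom)
  show ?thesis using h.hom_zpoly_eval[of \<rho> P] by (simp add: comp_def)
qed

lemma case_sum_proj: "(\<lambda>v. proj (case_sum u w v)) = case_sum (wproj u) (wproj w)"
  by (auto split: sum.split)

lemma wproj_add: "wproj u \<oplus>\<^bsub>W\<^esub> wproj v = wproj (zadd u v)"
  by (simp add: witt_ring_def zadd_def proj_zpoly_eval case_sum_proj)

lemma wproj_mult: "wproj u \<otimes>\<^bsub>W\<^esub> wproj v = wproj (zmult u v)"
  by (simp add: witt_ring_def zmult_def proj_zpoly_eval case_sum_proj)

text \<open>For p = 2 negating the components does not negate the ghost components, so the additive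
  inverse is obtained from Dwork's criterion instead of a formula.\<close>

lemma ex_zneg: "\<exists>v. \<forall>n. witt_poly p n v = - witt_poly p n (u :: nat \<Rightarrow> 'v zpoly)"
proof (rule dwork_lemma[OF prime_p])
  fix n
  have "of_nat p ^ Suc n dvd - (witt_poly p (Suc n) u - frob_lift p (witt_poly p n u))"
    using frob_lift_witt_poly[OF prime_p, of n u] by (simp only: dvd_minus_iff)
  then show "of_nat p ^ Suc n dvd - witt_poly p (Suc n) u - frob_lift p (- witt_poly p n u)"
    by (simp add: frob_lift_def teval_uminus)
qed

lemma witt_cring: "cring W"
proof (intro cringI abelian_groupI comm_monoidI)
  fix x y assume "x \<in> carrier W" "y \<in> carrier W"
  then obtain u v where *: "x = wproj u" "y = wproj v" by (metis ex_wproj)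
  then show "x \<oplus>\<^bsub>W\<^esub> y \<in> carrier W" "x \<otimes>\<^bsub>W\<^esub> y \<in> carrier W"
    by (simp_all add: wproj_add wproj_mult)
  show "x \<oplus>\<^bsub>W\<^esub> y = y \<oplus>\<^bsub>W\<^esub> x" "x \<otimes>\<^bsub>W\<^esub> y = y \<otimes>\<^bsub>W\<^esub> x"
    unfolding * wproj_add wproj_mult by (intro wproj_eqI'; simp add: algebra_simps)+
next
  fix x y z assume "x \<in> carrier W" "y \<in> carrier W" "z \<in> carrier W"
  then obtain u v w where *: "x = wproj u" "y = wproj v" "z = wproj w" by (metis ex_wproj)
  show "x \<oplus>\<^bsub>W\<^esub> y \<oplus>\<^bsub>W\<^esub> z = x \<oplus>\<^bsub>W\<^esub> (y \<oplus>\<^bsub>W\<^esub> z)"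
    "x \<otimes>\<^bsub>W\<^esub> y \<otimes>\<^bsub>W\<^esub> z = x \<otimes>\<^bsub>W\<^esub> (y \<otimes>\<^bsub>W\<^esub> z)"
    "(x \<oplus>\<^bsub>W\<^esub> y) \<otimes>\<^bsub>W\<^esub> z = x \<otimes>\<^bsub>W\<^esub> z \<oplus>\<^bsub>W\<^esub> y \<otimes>\<^bsub>W\<^esub> z"
    unfolding * wproj_add wproj_mult by (intro wproj_eqI'; simp add: algebra_simps)+
next
  fix x assume "x \<in> carrier W"
  then obtain u where x: "x = wproj u" by (metis ex_wproj)
  show "\<zero>\<^bsub>W\<^esub> \<oplus>\<^bsub>W\<^esub> x = x" "\<one>\<^bsub>W\<^esub> \<otimes>\<^bsub>W\<^esub> x = x"
    unfolding x wproj_add wproj_mult wproj_zero[symmetric] wproj_one[symmetric]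
    by (intro wproj_eqI'; simp add: p_pos witt_poly_teich)+
  obtain v where v: "\<And>n. witt_poly p n v = - witt_poly p n u" using ex_zneg by metis
  have "wproj v \<oplus>\<^bsub>W\<^esub> x = \<zero>\<^bsub>W\<^esub>"
    unfolding x wproj_add wproj_zero[symmetric] by (intro wproj_eqI') (simp add: v p_pos)
  then show "\<exists>y\<in>carrier W. y \<oplus>\<^bsub>W\<^esub> x = \<zero>\<^bsub>W\<^esub>" by (intro bexI[of _ "wproj v"]) simp_all
qed (auto simp: witt_carrier witt_zero witt_one teich_def split: nat.split)

lemma wproj_nat_mult:
  "\<exists>v. [k] \<cdot>\<^bsub>W\<^esub> wproj u = wproj v \<and> (\<forall>n. witt_poly p n v = of_nat k * witt_poly p n u)"
proof (induction k)
  case 0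
  interpret W: cring W by (rule witt_cring)
  show ?case by (intro exI[of _ "\<lambda>_. 0"]) (simp add: p_pos witt_zero)
next
  case (Suc k)
  interpret W: cring W by (rule witt_cring)
  from Suc obtain v where "[k] \<cdot>\<^bsub>W\<^esub> wproj u = wproj v"
    "\<And>n. witt_poly p n v = of_nat k * witt_poly p n u" by blast
  then show ?case
    by (intro exI[of _ "zadd v u"]) (simp add: wproj_add algebra_simps)
qed

section \<open>Identities for Teichmueller lifts, Verschiebung and Frobenius\<close>

lemma teich_closed [simp]: "a \<in> carrier R \<Longrightarrow> T a \<in> carrier W"
  and versch_closed [simp]: "w \<in> carrier W \<Longrightarrow> V w \<in> carrier W"
  and frob_closed [simp]: "w \<in> carrier W \<Longrightarrow> F w \<in> carrier W"
  by (auto simp: witt_carrier teich_def versch_def witt_frob_def split: nat.split)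

lemma teich_0 [simp]: "T a 0 = a" and versch_0 [simp]: "V w 0 = \<zero>"
  by (simp_all add: teich_def versch_def)

lemma ex_proj:
  assumes "a \<in> carrier R"
  obtains P where "a = proj P"
  using assms by (intro that[of "zvar a"]) (simp add: proj_def zpoly_eval_zvar[OF proj_range])

lemma teich_mult:
  assumes "a \<in> carrier R" "b \<in> carrier R"
  shows "T (a \<otimes> b) = T a \<otimes>\<^bsub>W\<^esub> T b"
proof -
  from assms obtain P Q where *: "a = proj P" "b = proj Q" by (metis ex_proj)
  show ?thesis unfolding * wproj_teich[symmetric] proj_mult[symmetric] wproj_mult
    by (intro wproj_eqI') (simp add: power_mult_distrib p_pos witt_poly_teich)
qed

lemma teich_frob: "a \<in> carrier R \<Longrightarrow> T (a [^] p) = F (T a)"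
  using p_pos by (auto simp: teich_def witt_frob_def nat_pow_zero split: nat.split)

lemma versch_add:
  assumes "x \<in> carrier W" "y \<in> carrier W"
  shows "V (x \<oplus>\<^bsub>W\<^esub> y) = V x \<oplus>\<^bsub>W\<^esub> V y"
proof -
  from assms obtain u v where *: "x = wproj u" "y = wproj v" by (metis ex_wproj)
  show ?thesis unfolding * wproj_versch[symmetric] wproj_add
  proof (rule wproj_eqI')
    fix n show "witt_poly p n (versch type_ring (zadd u v)) =
      witt_poly p n (zadd (versch type_ring u) (versch type_ring v))"
      by (cases n) (simp_all add: witt_poly_versch_Suc p_pos distrib_left)
  qed
qed

text \<open>The projection formula. Componentwise p-th powers miss the last term p^n u_n of the
  ghost component, and V supplies one more factor p, so the error lies within the precision p^(n+1)
  that projection to R ignores.\<close>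

lemma mult_versch:
  assumes "x \<in> carrier W" "y \<in> carrier W"
  shows "x \<otimes>\<^bsub>W\<^esub> V y = V (F x \<otimes>\<^bsub>W\<^esub> y)"
proof -
  from assms obtain u v where *: "x = wproj u" "y = wproj v" by (metis ex_wproj)
  show ?thesis unfolding * wproj_versch[symmetric] wproj_mult wproj_frob[symmetric]
  proof (rule wproj_eqI)
    fix n show "of_nat p ^ Suc n dvd witt_poly p n (zmult u (versch type_ring v)) -
      witt_poly p n (versch type_ring (zmult (\<lambda>n. u n ^ p) v))"
    proof (cases n)
      case (Suc m)
      have "witt_poly p n (zmult u (versch type_ring v)) -
          witt_poly p n (versch type_ring (zmult (\<lambda>n. u n ^ p) v)) =
          of_nat p ^ Suc n * (u n * witt_poly p m v)"
        by (simp add: Suc witt_poly_versch_Suc p_pos) (simp add: witt_poly_Suc algebra_simps)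
      then show ?thesis by simp
    qed simp
  qed
qed

text \<open>The n-th ghost components of V (F u) and p u differ exactly by p^(n+1) u_n, which is
  invisible in characteristic p.\<close>

lemma versch_frob:
  assumes "x \<in> carrier W"
  shows "V (F x) = [p] \<cdot>\<^bsub>W\<^esub> x"
proof -
  from assms obtain u where x: "x = wproj u" by (metis ex_wproj)
  obtain v where v: "[p] \<cdot>\<^bsub>W\<^esub> wproj u = wproj v" "\<And>n. witt_poly p n v = of_nat p * witt_poly p n u"
    using wproj_nat_mult by metis
  then have v0: "v 0 = of_nat p * u 0" using witt_poly_0 by metis
  show ?thesis unfolding x v wproj_versch[symmetric] wproj_frob[symmetric]
  proof (rule wproj_eqI)
    fix n
    have "of_nat p ^ Suc n dvd of_nat p ^ Suc n * - u n" by simp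
    also have "\<dots> = witt_poly p n (versch type_ring (\<lambda>n. u n ^ p)) - witt_poly p n v"
    proof (cases n)
      case (Suc m)
      then show ?thesis
        by (simp add: v witt_poly_versch_Suc p_pos) (simp add: witt_poly_Suc algebra_simps)
    qed (simp add: v0)
    finally show "of_nat p ^ Suc n dvd witt_poly p n (versch type_ring (\<lambda>n. u n ^ p)) - witt_poly p n v" .
  qed
qed

lemma frob_versch:
  assumes "x \<in> carrier W"
  shows "F (V x) = [p] \<cdot>\<^bsub>W\<^esub> x"
proof -
  have "F (V x) = V (F x)"
    using p_pos by (auto simp: witt_frob_def versch_def nat_pow_zero split: nat.split)
  then show ?thesis using versch_frob[OF assms] by simp
qed

text \<open>Up to p^(n+1) times a component, the n-th ghost component of F u is the (n+1)-st one of
  u. So F shifts ghost components at the relevant precision and inherits additivity; the same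
  argument gives multiplicativity.\<close>

lemma frob_add:
  assumes "x \<in> carrier W" "y \<in> carrier W"
  shows "F (x \<oplus>\<^bsub>W\<^esub> y) = F x \<oplus>\<^bsub>W\<^esub> F y"
proof -
  from assms obtain u v where *: "x = wproj u" "y = wproj v" by (metis ex_wproj)
  show ?thesis unfolding * wproj_add wproj_frob[symmetric]
  proof (rule wproj_eqI)
    fix n
    let ?w = "zadd u v" 
    have g: "witt_poly p n (\<lambda>i. f i ^ p) = witt_poly p (Suc n) f - of_nat p ^ Suc n * f (Suc n)"
      for f :: "nat \<Rightarrow> 'a zpoly" by (simp add: witt_poly_Suc)
    have "witt_poly p n (\<lambda>i. ?w i ^ p) - witt_poly p n (zadd (\<lambda>i. u i ^ p) (\<lambda>i. v i ^ p)) =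
        of_nat p ^ Suc n * (u (Suc n) + v (Suc n) - ?w (Suc n))"
      by (simp add: g algebra_simps)
    then show "of_nat p ^ Suc n dvd witt_poly p n (\<lambda>i. ?w i ^ p) -
        witt_poly p n (zadd (\<lambda>i. u i ^ p) (\<lambda>i. v i ^ p))" by simp
  qed
qed

lemma frob_mult:
  assumes "x \<in> carrier W" "y \<in> carrier W"
  shows "F (x \<otimes>\<^bsub>W\<^esub> y) = F x \<otimes>\<^bsub>W\<^esub> F y"
proof -
  from assms obtain u v where *: "x = wproj u" "y = wproj v" by (metis ex_wproj)
  show ?thesis unfolding * wproj_mult wproj_frob[symmetric]
  proof (rule wproj_eqI)
    fix n
    let ?w = "zmult u v" and ?u = "witt_poly p (Suc n) u" and ?v = "witt_poly p (Suc n) v"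
    have g: "witt_poly p n (\<lambda>i. f i ^ p) = witt_poly p (Suc n) f - of_nat p ^ Suc n * f (Suc n)"
      for f :: "nat \<Rightarrow> 'a zpoly" by (simp add: witt_poly_Suc)
    have "witt_poly p n (\<lambda>i. ?w i ^ p) - witt_poly p n (zmult (\<lambda>i. u i ^ p) (\<lambda>i. v i ^ p)) =
        of_nat p ^ Suc n * (u (Suc n) * ?v + v (Suc n) * ?u
          - of_nat p ^ Suc n * u (Suc n) * v (Suc n) - ?w (Suc n))"
      by (simp add: g algebra_simps)
    then show "of_nat p ^ Suc n dvd witt_poly p n (\<lambda>i. ?w i ^ p) -
        witt_poly p n (zmult (\<lambda>i. u i ^ p) (\<lambda>i. v i ^ p))" by simp
  qed
qed

lemma frob_one: "F \<one>\<^bsub>W\<^esub> = \<one>\<^bsub>W\<^esub>"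
  using teich_frob[of \<one>] by (simp add: witt_one)

lemma frob_hom: "ring_hom_cring W W F"
  by (intro ring_hom_cring.intro ring_hom_cring_axioms.intro witt_cring ring_hom_memI)
    (simp_all add: frob_add frob_mult frob_one)

lemma component0_add:
  assumes "x \<in> carrier W" "y \<in> carrier W"
  shows "(x \<oplus>\<^bsub>W\<^esub> y) 0 = x 0 \<oplus> y 0"
proof -
  from assms obtain u v where *: "x = wproj u" "y = wproj v" by (metis ex_wproj)
  then show ?thesis by (simp add: * wproj_add proj_add)
qed

lemma component0_mult:
  assumes "x \<in> carrier W" "y \<in> carrier W"
  shows "(x \<otimes>\<^bsub>W\<^esub> y) 0 = x 0 \<otimes> y 0"
proof -
  from assms obtain u v where *: "x = wproj u" "y = wproj v" by (metis ex_wproj)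
  then show ?thesis by (simp add: * wproj_mult proj_mult)
qed

lemma component0_hom: "ring_hom_cring W R (\<lambda>w. w 0)"
  by (intro ring_hom_cring.intro ring_hom_cring_axioms.intro witt_cring is_cring ring_hom_memI)
    (simp_all add: component0_add component0_mult witt_one)

lemma teich_versch_decomp:
  assumes "x \<in> carrier W"
  shows "x = T (x 0) \<oplus>\<^bsub>W\<^esub> V (\<lambda>n. x (Suc n))"
proof -
  from assms obtain u where x: "x = wproj u" by (metis ex_wproj)
  have "witt_poly p n u = witt_poly p n (zadd (teich type_ring (u 0)) (versch type_ring (\<lambda>n. u (Suc n))))" for n
    by (cases n) (simp_all add: witt_poly_versch_Suc witt_poly_teich p_pos, simp_all add: witt_poly_Suc_shift)
  from wproj_eqI'[OF this] show ?thesis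
    unfolding x wproj_add[symmetric] wproj_teich wproj_versch .
qed

lemma versch_inj: "V x = V y \<Longrightarrow> x = y"
  by (auto simp: versch_def fun_eq_iff split: nat.splits)

lemma component0_zero_versch:
  assumes "x \<in> carrier W" "x 0 = \<zero>"
  obtains y where "y \<in> carrier W" "x = V y"
  using assms by (intro that[of "\<lambda>n. x (Suc n)"]) (auto simp: witt_carrier versch_def fun_eq_iff split: nat.split)

end

section \<open>Witt vectors modulo \<open>p\<close>\<close>

text \<open>Common form of all well-definedness arguments for induced maps: on a nonempty coset,
  constancy determines the value.\<close>

lemma the_elem_image_const:
  assumes "x \<in> A" "\<And>y. y \<in> A \<Longrightarrow> f y = z"
  shows "the_elem (f ` A) = z"
proof -
  have "f ` A = {z}" using assms by blast
  then show ?thesis by simp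
qed

text \<open>Evaluation of a universal identity in two variables, indexed by \<open>bool\<close>. The
  linear term is kept apart because it later yields y^(p-1) V D; the cofactor is kept as a
  polynomial value so that it stays in any subring containing a and b.\<close>

lemma (in cring) prime_binomial_expansion:
  fixes p :: nat
  assumes p: "Factorial_Ring.prime p" and a: "a \<in> carrier R" and b: "b \<in> carrier R"
  obtains P where "(a \<oplus> b) [^] p = a [^] p \<oplus> [p] \<cdot> (a [^] (p - 1) \<otimes> b) \<oplus>
    [p] \<cdot> (b [^] (2::nat) \<otimes> zpoly_eval R (\<lambda>i::bool. if i then a else b) P) \<oplus> b [^] p"
proof -
  define \<rho> where "\<rho> = (\<lambda>i::bool. if i then a else b)"
  have \<rho>: "range \<rho> \<subseteq> carrier R" using a b by (auto simp: \<rho>_def)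
  obtain P :: "bool zpoly" where "(zvar True + zvar False) ^ p = zvar True ^ p
      + of_nat p * zvar True ^ (p - 1) * zvar False + of_nat p * ((zvar False)\<^sup>2 * P) + zvar False ^ p"
    using p by (rule comm_ring_prime_binomial_expansion)
  from arg_cong[OF this, of "zpoly_eval R \<rho>"]
  have "(\<rho> True \<oplus> \<rho> False) [^] p = \<rho> True [^] p \<oplus> [p] \<cdot> (\<rho> True [^] (p - 1) \<otimes> \<rho> False) \<oplus>
      [p] \<cdot> (\<rho> False [^] (2::nat) \<otimes> zpoly_eval R \<rho> P) \<oplus> \<rho> False [^] p"
    unfolding mult.assoc zpoly_eval_power[OF \<rho>] zpoly_eval_add[OF \<rho>] zpoly_eval_of_nat_mult[OF \<rho>]
    unfolding zpoly_eval_mult[OF \<rho>] zpoly_eval_power[OF \<rho>] zpoly_eval_zvar[OF \<rho>] .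
  then show thesis using that[of P] by (simp add: \<rho>_def)
qed

context witt_char_p
begin

sublocale W: cring "witt_ring R p"
  by (rule witt_cring)

sublocale F: ring_hom_cring "witt_ring R p" "witt_ring R p" "witt_frob R p"
  by (rule frob_hom)

sublocale c0: ring_hom_cring "witt_ring R p" R "\<lambda>w. w 0"
  by (rule component0_hom)

abbreviation B where "B \<equiv> Wbar R p"
abbreviation q where "q \<equiv> Wbar_of R p"
abbreviation \<tau> where "\<tau> \<equiv> Wbar_teich R p"

lemma \<tau>_def: "\<tau> a = q (T a)"
  by (simp add: Wbar_teich_def)

lemma p_ideal: "ideal (witt_p_ideal R p) W"
  unfolding witt_p_ideal_def by (rule W.cgenideal_ideal) simp

sublocale I: ideal "witt_p_ideal R p" "witt_ring R p"
  by (rule p_ideal)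

sublocale q: ring_hom_cring "witt_ring R p" "Wbar R p" "Wbar_of R p"
  using I.rcos_ring_hom_cring[OF W.is_cring] unfolding Wbar_def Wbar_of_def[abs_def] .

lemma p_ideal_eq: "witt_p_ideal R p = (\<lambda>c. [p] \<cdot>\<^bsub>W\<^esub> c) ` carrier W"
proof -
  have "c \<otimes>\<^bsub>W\<^esub> [p] \<cdot>\<^bsub>W\<^esub> \<one>\<^bsub>W\<^esub> = [p] \<cdot>\<^bsub>W\<^esub> c" if "c \<in> carrier W" for c
    using that by (simp add: W.add_pow_rdistr)
  then show ?thesis
    unfolding witt_p_ideal_def cgenideal_def Setcompr_eq_image Collect_mem_eq by (rule image_cong[OF refl])
qed

lemma q_eq_iff:
  assumes "a \<in> carrier W" "b \<in> carrier W"
  shows "q a = q b \<longleftrightarrow> (\<exists>c\<in>carrier W. a = [p] \<cdot>\<^bsub>W\<^esub> c \<oplus>\<^bsub>W\<^esub> b)"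
proof -
  have "q a = q b \<longleftrightarrow> a \<in> witt_p_ideal R p +>\<^bsub>W\<^esub> b"
    unfolding Wbar_of_def using I.a_repr_independenceD I.a_repr_independence' assms by metis
  also have "\<dots> \<longleftrightarrow> (\<exists>c\<in>carrier W. a = [p] \<cdot>\<^bsub>W\<^esub> c \<oplus>\<^bsub>W\<^esub> b)"
    unfolding a_r_coset_def' p_ideal_eq by auto
  finally show ?thesis .
qed

lemma carrier_B: "carrier B = q ` carrier W"
  unfolding Wbar_def Wbar_of_def[abs_def] FactRing_simps by auto

lemma ex_q:
  assumes "\<alpha> \<in> carrier B"
  obtains a where "a \<in> carrier W" "\<alpha> = q a"
  using assms by (auto simp: carrier_B)

lemma q_p_mult: "a \<in> carrier W \<Longrightarrow> q ([p] \<cdot>\<^bsub>W\<^esub> a) = \<zero>\<^bsub>B\<^esub>"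
  using q_eq_iff[of "[p] \<cdot>\<^bsub>W\<^esub> a" "\<zero>\<^bsub>W\<^esub>"] by auto

lemma q_eq_zeroE:
  assumes "a \<in> carrier W" "q a = \<zero>\<^bsub>B\<^esub>"
  obtains c where "c \<in> carrier W" "a = [p] \<cdot>\<^bsub>W\<^esub> c"
  using q_eq_iff[of a "\<zero>\<^bsub>W\<^esub>"] assms by auto

lemma p_mult_B: "\<alpha> \<in> carrier B \<Longrightarrow> [p] \<cdot>\<^bsub>B\<^esub> \<alpha> = \<zero>\<^bsub>B\<^esub>"
proof -
  assume "\<alpha> \<in> carrier B"
  then obtain a where a: "a \<in> carrier W" "\<alpha> = q a" by (rule ex_q)
  have "q ([k] \<cdot>\<^bsub>W\<^esub> a) = [k] \<cdot>\<^bsub>B\<^esub> q a" for k :: nat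
    using a by (induction k) simp_all
  then show ?thesis using q_p_mult a by metis
qed

lemma versch_p_mult: "a \<in> carrier W \<Longrightarrow> V ([p] \<cdot>\<^bsub>W\<^esub> a) = [p] \<cdot>\<^bsub>W\<^esub> V a"
  using versch_frob[of "V a"] frob_versch[of a] by simp

lemma q_versch_cong:
  assumes "a \<in> carrier W" "b \<in> carrier W" "q a = q b"
  shows "q (V a) = q (V b)"
proof -
  from assms obtain c where c: "c \<in> carrier W" "a = [p] \<cdot>\<^bsub>W\<^esub> c \<oplus>\<^bsub>W\<^esub> b" using q_eq_iff by blast
  then have "V a = [p] \<cdot>\<^bsub>W\<^esub> V c \<oplus>\<^bsub>W\<^esub> V b" using assms by (simp add: versch_add versch_p_mult)
  then show ?thesis using c assms by (subst q_eq_iff) auto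
qed

lemma q_self: "a \<in> carrier W \<Longrightarrow> a \<in> q a"
  unfolding Wbar_of_def by (rule I.a_rcos_self)

lemma mem_q: "b \<in> q a \<Longrightarrow> a \<in> carrier W \<Longrightarrow> b \<in> carrier W \<and> q b = q a"
  using I.a_elemrcos_carrier[of a b] I.a_repr_independence'[of b a] by (simp add: Wbar_of_def)

lemma Wbar_versch_q: "a \<in> carrier W \<Longrightarrow> Wbar_versch R p (q a) = q (V a)"
  unfolding Wbar_versch_def
  by (rule the_elem_image_const, erule q_self, metis q_versch_cong mem_q)

lemma component0_cong:
  assumes "a \<in> carrier W" "b \<in> carrier W" "q a = q b"
  shows "a 0 = b 0"
proof -
  from assms obtain c where c: "c \<in> carrier W" "a = [p] \<cdot>\<^bsub>W\<^esub> c \<oplus>\<^bsub>W\<^esub> b" using q_eq_iff by blast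
  have "([p] \<cdot>\<^bsub>W\<^esub> c) 0 = \<zero>" using c by (simp flip: versch_frob)
  then show ?thesis using c assms by simp
qed

lemma Wbar_component0_q: "a \<in> carrier W \<Longrightarrow> Wbar_component0 R p (q a) = a 0"
  unfolding Wbar_component0_def
  by (rule the_elem_image_const, erule q_self, metis component0_cong mem_q)

lemma \<tau>_closed [simp]: "a \<in> carrier R \<Longrightarrow> \<tau> a \<in> carrier B"
  by (simp add: \<tau>_def)

lemma \<tau>_mult: "a \<in> carrier R \<Longrightarrow> b \<in> carrier R \<Longrightarrow> \<tau> (a \<otimes> b) = \<tau> a \<otimes>\<^bsub>B\<^esub> \<tau> b"
  by (simp add: \<tau>_def teich_mult)

lemma \<tau>_one: "\<tau> \<one> = \<one>\<^bsub>B\<^esub>"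
  by (simp add: \<tau>_def flip: witt_one)

lemma teich_zero: "T \<zero> = \<zero>\<^bsub>W\<^esub>"
  by (auto simp: witt_zero teich_def split: nat.split)

lemma \<tau>_zero: "\<tau> \<zero> = \<zero>\<^bsub>B\<^esub>"
  by (simp add: \<tau>_def teich_zero)

lemma teich_pow: "a \<in> carrier R \<Longrightarrow> T (a [^] (k::nat)) = T a [^]\<^bsub>W\<^esub> k"
  by (induction k) (simp_all add: teich_mult witt_one)

text \<open>\<open>F V = p\<close>, so modulo \<open>p\<close> the Frobenius depends only on the zeroth component.\<close>

lemma frob_decomp:
  assumes "x \<in> carrier W"
  obtains y where "y \<in> carrier W" "F x = [p] \<cdot>\<^bsub>W\<^esub> y \<oplus>\<^bsub>W\<^esub> T (x 0 [^] p)"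
proof (rule that)
  let ?y = "\<lambda>n. x (Suc n)"
  show y: "?y \<in> carrier W" using assms by (auto simp: witt_carrier)
  have "F x = F (T (x 0) \<oplus>\<^bsub>W\<^esub> V ?y)" using teich_versch_decomp[OF assms] by simp
  also have "\<dots> = F (T (x 0)) \<oplus>\<^bsub>W\<^esub> F (V ?y)" using assms y by simp
  finally show "F x = [p] \<cdot>\<^bsub>W\<^esub> ?y \<oplus>\<^bsub>W\<^esub> T (x 0 [^] p)"
    using assms y by (simp add: frob_versch teich_frob W.a_comm)
qed

lemma q_frob: "x \<in> carrier W \<Longrightarrow> q (F x) = \<tau> (x 0 [^] p)"
  by (rule frob_decomp[of x]) (auto simp: q_p_mult \<tau>_def)

text \<open>F ([a] + [b]) is determined modulo p by the zeroth component a + b. This additivity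
  makes the [a^p] a subgroup and lets like p-monomials be merged.\<close>

lemma \<tau>_frob_add:
  assumes "a \<in> carrier R" "b \<in> carrier R"
  shows "\<tau> (a [^] p) \<oplus>\<^bsub>B\<^esub> \<tau> (b [^] p) = \<tau> ((a \<oplus> b) [^] p)"
  using q_frob[of "T a \<oplus>\<^bsub>W\<^esub> T b"] assms by (simp add: \<tau>_def teich_frob)

lemma frobenius_add:
  assumes "a \<in> carrier R" "b \<in> carrier R"
  shows "(a \<oplus> b) [^] p = a [^] p \<oplus> b [^] p"
  using arg_cong[OF \<tau>_frob_add[OF assms], of "Wbar_component0 R p"] assms
  by (simp add: \<tau>_def Wbar_component0_q flip: q.hom_add)

lemma frobenius_uminus:
  assumes "a \<in> carrier R"
  shows "(\<ominus> a) [^] p = \<ominus> (a [^] p)"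
  using frobenius_add[of "\<ominus> a" a] assms p_pos
  by (intro minus_equality[symmetric]) (simp_all add: l_neg nat_pow_zero)

section \<open>The cokernels R/F(R) and of a -> [a^p]\<close>

lemma frob_image_subgroup: "additive_subgroup (frob_image R p) R"
proof (intro additive_subgroup.intro add.subgroupI)
  show "frob_image R p \<noteq> {}" by (auto simp: frob_image_def)
  show "\<ominus> a \<in> frob_image R p" if "a \<in> frob_image R p" for a
    using that by (auto simp: frob_image_def simp flip: frobenius_uminus)
  show "a \<oplus> b \<in> frob_image R p" if "a \<in> frob_image R p" "b \<in> frob_image R p" for a b
    using that by (auto simp: frob_image_def simp flip: frobenius_add)
qed (auto simp: frob_image_def)

lemma Wbar_frob_subgroup: "additive_subgroup (Wbar_frob R p) B"
proof (intro additive_subgroup.intro q.S.add.subgroupI)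
  show "\<ominus>\<^bsub>B\<^esub> a \<in> Wbar_frob R p" if "a \<in> Wbar_frob R p" for a
  proof -
    from that obtain r where r: "r \<in> carrier R" "a = \<tau> (r [^] p)" by (auto simp: Wbar_frob_def)
    then have "\<ominus>\<^bsub>B\<^esub> a = \<tau> ((\<ominus> r) [^] p)"
      using \<tau>_frob_add[of "\<ominus> r" r] p_pos
      by (intro q.S.minus_equality) (simp_all add: l_neg nat_pow_zero \<tau>_zero)
    then show ?thesis using r by (auto simp: Wbar_frob_def)
  qed
qed (auto simp: Wbar_frob_def \<tau>_frob_add)

sublocale K: abelian_subgroup "Wbar_frob R p" "Wbar R p"
  by (rule abelian_subgroupI3[OF Wbar_frob_subgroup q.S.abelian_group_axioms])

sublocale K0: abelian_subgroup "frob_image R p" R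
  by (rule abelian_subgroupI3[OF frob_image_subgroup abelian_group_axioms])

lemma mem_frob_coset: "b \<in> frob_image R p +> d \<longleftrightarrow> (\<exists>r\<in>carrier R. b = r [^] p \<oplus> d)"
  unfolding a_r_coset_def' frob_image_def by blast

abbreviation C where "C \<equiv> Wcoker_of R p"

lemma mem_C: "\<beta> \<in> C \<alpha> \<longleftrightarrow> (\<exists>r\<in>carrier R. \<beta> = \<tau> (r [^] p) \<oplus>\<^bsub>B\<^esub> \<alpha>)"
  by (auto simp: Wcoker_of_def a_r_coset_def' Wbar_frob_def)

lemma C_self: "\<alpha> \<in> carrier B \<Longrightarrow> \<alpha> \<in> C \<alpha>"
  unfolding Wcoker_of_def by (rule K.a_rcos_self)

lemma C_frob_add:
  "r \<in> carrier R \<Longrightarrow> \<alpha> \<in> carrier B \<Longrightarrow> C (\<tau> (r [^] p) \<oplus>\<^bsub>B\<^esub> \<alpha>) = C \<alpha>"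
  using K.a_repr_independence'[of _ \<alpha>] mem_C unfolding Wcoker_of_def by metis

lemma carrier_Wcoker: "carrier (Wcoker R p) = C ` carrier B"
  unfolding Wcoker_def Wcoker_of_def[abs_def] by (auto simp: A_FactGroup_def' A_RCOSETS_def')

text \<open>Changing the representative by [r^p] adds V [r^p] = V (F [r]) = p [r], which vanishes
  modulo p.\<close>

lemma Wcoker_versch_C:
  assumes "a \<in> carrier W"
  shows "Wcoker_versch R p (C (q a)) = q (V a)"
  unfolding Wcoker_versch_def
proof (rule the_elem_image_const[OF C_self])
  fix \<beta> assume "\<beta> \<in> C (q a)"
  then obtain r where r: "r \<in> carrier R" "\<beta> = \<tau> (r [^] p) \<oplus>\<^bsub>B\<^esub> q a" by (auto simp: mem_C)
  then have "Wbar_versch R p \<beta> = q (V (F (T r) \<oplus>\<^bsub>W\<^esub> a))"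
    using assms Wbar_versch_q[of "F (T r) \<oplus>\<^bsub>W\<^esub> a"] by (simp add: \<tau>_def teich_frob)
  also have "\<dots> = q (V a)" using r assms by (simp add: versch_add versch_frob q_p_mult)
  finally show "Wbar_versch R p \<beta> = q (V a)" .
qed (simp add: assms)

lemma Wcoker_component0_C:
  assumes "a \<in> carrier W"
  shows "Wcoker_component0 R p (C (q a)) = frob_image R p +> a 0"
  unfolding Wcoker_component0_def
proof (rule the_elem_image_const[OF C_self])
  fix \<beta> assume "\<beta> \<in> C (q a)"
  then obtain r where r: "r \<in> carrier R" "\<beta> = \<tau> (r [^] p) \<oplus>\<^bsub>B\<^esub> q a" by (auto simp: mem_C)
  then have "Wbar_component0 R p \<beta> = r [^] p \<oplus> a 0"
    using assms Wbar_component0_q[of "T (r [^] p) \<oplus>\<^bsub>W\<^esub> a"] by (simp add: \<tau>_def)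
  moreover have "r [^] p \<oplus> a 0 \<in> frob_image R p +> a 0"
    using r mem_frob_coset by blast
  ultimately show "frob_image R p +> Wbar_component0 R p \<beta> = frob_image R p +> a 0"
    using K0.a_repr_independence' assms by (metis witt_component)
qed (simp add: assms)

lemma frob_quot_mult_coset:
  assumes "h \<in> carrier R" "d \<in> carrier R"
  shows "frob_quot_mult R p (h [^] p) (frob_image R p +> d) = frob_image R p +> (h [^] p \<otimes> d)"
  unfolding frob_quot_mult_def
proof (rule the_elem_image_const)
  show "d \<in> frob_image R p +> d" using assms by (simp add: K0.a_rcos_self)
  fix b assume "b \<in> frob_image R p +> d"
  then obtain r where r: "r \<in> carrier R" "b = r [^] p \<oplus> d"
    using mem_frob_coset by blast
  then have "h [^] p \<otimes> b = (h \<otimes> r) [^] p \<oplus> h [^] p \<otimes> d"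
    using assms by (simp add: r_distr nat_pow_distrib)
  then have "h [^] p \<otimes> b \<in> frob_image R p +> (h [^] p \<otimes> d)"
    using r assms mem_frob_coset by (metis m_closed)
  then show "frob_image R p +> (h [^] p \<otimes> b) = frob_image R p +> (h [^] p \<otimes> d)"
    using K0.a_repr_independence' assms by (metis m_closed nat_pow_closed)
qed

section \<open>Powers of Verschiebung elements\<close>

lemma versch_mult:
  assumes "x \<in> carrier W" "y \<in> carrier W"
  shows "V x \<otimes>\<^bsub>W\<^esub> V y = [p] \<cdot>\<^bsub>W\<^esub> V (x \<otimes>\<^bsub>W\<^esub> y)"
  using assms mult_versch[of "V x" y] by (simp add: frob_versch W.add_pow_ldistr versch_p_mult)

lemma versch_pow:
  assumes x: "x \<in> carrier W"
  shows "V x [^]\<^bsub>W\<^esub> Suc k = [(p ^ k)] \<cdot>\<^bsub>W\<^esub> V (x [^]\<^bsub>W\<^esub> Suc k)"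
proof (induction k)
  case (Suc k)
  have "V x [^]\<^bsub>W\<^esub> Suc (Suc k) = [(p ^ k)] \<cdot>\<^bsub>W\<^esub> (V (x [^]\<^bsub>W\<^esub> Suc k) \<otimes>\<^bsub>W\<^esub> V x)"
    using Suc x by (simp add: W.add_pow_ldistr)
  also have "\<dots> = [(p ^ k)] \<cdot>\<^bsub>W\<^esub> ([p] \<cdot>\<^bsub>W\<^esub> V (x [^]\<^bsub>W\<^esub> Suc (Suc k)))"
    using x by (subst versch_mult) simp_all
  finally show ?case using x by (simp add: W.add.nat_pow_pow mult.commute)
qed (use x in simp)

lemma versch_pow_p:
  assumes x: "x \<in> carrier W"
  shows "V x [^]\<^bsub>W\<^esub> p = [p] \<cdot>\<^bsub>W\<^esub> ([(p ^ (p - 2))] \<cdot>\<^bsub>W\<^esub> V (x [^]\<^bsub>W\<^esub> p))"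
proof -
  obtain k where k: "p = Suc (Suc k)"
    using prime_ge_2_nat[OF prime_p] by (metis add_2_eq_Suc le_Suc_ex)
  have "p - 2 = k" using k by simp
  moreover have "V x [^]\<^bsub>W\<^esub> p = [(p ^ Suc k)] \<cdot>\<^bsub>W\<^esub> V (x [^]\<^bsub>W\<^esub> p)"
    using versch_pow[OF x, of "Suc k"] by (simp only: k[symmetric])
  ultimately show ?thesis using x by (simp add: W.add.nat_pow_pow mult.commute)
qed

text \<open>F lifts the p-th power map of W(R)/p: both agree on the Teichmueller part, and every
  contribution of the V part is a multiple of p.\<close>

lemma q_pow_p:
  assumes "x \<in> carrier W"
  shows "q (x [^]\<^bsub>W\<^esub> p) = q (F x)"
proof -
  let ?a = "T (x 0)" and ?b = "V (\<lambda>n. x (Suc n))"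
  have b: "(\<lambda>n. x (Suc n)) \<in> carrier W" using assms by (auto simp: witt_carrier)
  then have c: "?a \<in> carrier W" "?b \<in> carrier W" using assms by simp_all
  obtain P where "(?a \<oplus>\<^bsub>W\<^esub> ?b) [^]\<^bsub>W\<^esub> p = ?a [^]\<^bsub>W\<^esub> p \<oplus>\<^bsub>W\<^esub>
      [p] \<cdot>\<^bsub>W\<^esub> (?a [^]\<^bsub>W\<^esub> (p - 1) \<otimes>\<^bsub>W\<^esub> ?b) \<oplus>\<^bsub>W\<^esub>
      [p] \<cdot>\<^bsub>W\<^esub> (?b [^]\<^bsub>W\<^esub> (2::nat) \<otimes>\<^bsub>W\<^esub> zpoly_eval W (\<lambda>i::bool. if i then ?a else ?b) P) \<oplus>\<^bsub>W\<^esub>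
      ?b [^]\<^bsub>W\<^esub> p"
    using W.prime_binomial_expansion[OF prime_p c] by metis
  moreover have "zpoly_eval W (\<lambda>i::bool. if i then ?a else ?b) P \<in> carrier W"
    using c by (intro W.zpoly_eval_closed) auto
  moreover note versch_pow_p[OF b]
  ultimately have "q ((?a \<oplus>\<^bsub>W\<^esub> ?b) [^]\<^bsub>W\<^esub> p) = q (?a [^]\<^bsub>W\<^esub> p)"
    using b c by (simp add: q_p_mult del: q.hom_pow)
  then show ?thesis using teich_versch_decomp[OF assms] assms
    by (simp add: q_frob \<tau>_def teich_pow del: q.hom_pow)
qed

text \<open>For p = 2 the coefficient p^(p-2) left in \<open>versch_pow_p\<close> is 1, so the
  second factor p must come from elsewhere: x^p agrees with F x modulo p, and V (F x) = p x.\<close>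

lemma q_versch_pow_p:
  fixes j :: nat
  assumes x: "x \<in> carrier W"
  shows "q ([j] \<cdot>\<^bsub>W\<^esub> V (x [^]\<^bsub>W\<^esub> p)) = \<zero>\<^bsub>B\<^esub>"
proof -
  have xp: "x [^]\<^bsub>W\<^esub> p \<in> carrier W" using x by simp
  have "q (V (x [^]\<^bsub>W\<^esub> p)) = \<zero>\<^bsub>B\<^esub>"
    using q_versch_cong[OF xp frob_closed[OF x] q_pow_p[OF x]] x by (simp add: versch_frob q_p_mult)
  then show ?thesis using xp by (induction j) simp_all
qed

end

lemma (in comm_monoid) finprod_nat_pow:
  "f \<in> A \<rightarrow> carrier G \<Longrightarrow> (\<Otimes>i\<in>A. f i) [^] (k::nat) = (\<Otimes>i\<in>A. f i [^] k)"
  by (induction A rule: infinite_finite_induct) (simp_all add: nat_pow_distrib Pi_def)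

lemma (in cring) finsum_in_additive_closed:
  assumes "finite A" "\<And>i. i \<in> A \<Longrightarrow> f i \<in> H" "H \<subseteq> carrier R" "\<zero> \<in> H"
    and "\<And>a b. a \<in> H \<Longrightarrow> b \<in> H \<Longrightarrow> a \<oplus> b \<in> H"
  shows "(\<Oplus>i\<in>A. f i) \<in> H"
proof -
  have "(\<Oplus>i\<in>B. f i) \<in> H" if "B \<subseteq> A" for B
    using finite_subset[OF that assms(1)] that
  proof (induction B)
    case (insert b B)
    then have "f b \<in> carrier R" "f \<in> B \<rightarrow> carrier R" using assms(2,3) by auto
    then show ?case using insert assms(2,5) by (simp add: finsum_insert)
  qed (simp add: assms)
  then show ?thesis by simp
qed

section \<open>Rings with a p-basis and the absence of p-torsion in W(R)\<close>

locale p_basis_ring = witt_char_p R p for R (structure) and p :: nat +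
  fixes N :: nat and x :: "nat \<Rightarrow> 'a"
  assumes x_closed: "x \<in> {1..N} \<rightarrow> carrier R"
    and basis: "module_basis R (frob_pushforward R p) (frob_exponents p N) (frob_monomial R N x)"
begin

definition E where "E = frob_exponents p N"
abbreviation v where "v \<equiv> frob_monomial R N x"
abbreviation M where "M \<equiv> p_monomials R p N x"
abbreviation S where "S \<equiv> p_monomial_teich_sums R p N x"

lemma finite_E: "finite E"
  by (simp add: E_def finite_PiE)

lemma finsum_pushforward: "finsum (frob_pushforward R p) f A = finsum R f A"
  by (simp add: finsum_def finprod_def frob_pushforward_def)

lemma v_closed [simp]: "v e \<in> carrier R"
  unfolding frob_monomial_def using x_closed by (intro finprod_closed) auto

lemma ex_expansion:
  assumes "f \<in> carrier R"
  obtains b where "b \<in> E \<rightarrow> carrier R" "f = (\<Oplus>e\<in>E. b e [^] p \<otimes> v e)"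
  using basis assms unfolding module_basis_def finsum_pushforward E_def by (auto simp: frob_pushforward_def)

lemma expansion_zero:
  assumes "b \<in> E \<rightarrow> carrier R" "(\<Oplus>e\<in>E. b e [^] p \<otimes> v e) = \<zero>" "e \<in> E"
  shows "b e = \<zero>"
  using basis assms unfolding module_basis_def finsum_pushforward E_def by (auto simp: frob_pushforward_def)

lemma zero_in_E: "(\<lambda>i\<in>{1..N}. 0) \<in> E"
  by (auto simp: E_def)

lemma v_zero: "v (\<lambda>i\<in>{1..N}. 0) = \<one>"
  unfolding frob_monomial_def by (rule finprod_one_eqI) simp

text \<open>If a^p = 0, the family with all coefficients equal to a gives a vanishing combination of
  basis elements, so independence yields a = 0.\<close>

lemma frobenius_inj:
  assumes a: "a \<in> carrier R" and "a [^] p = \<zero>"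
  shows "a = \<zero>"
  using expansion_zero[of "\<lambda>_. a", OF _ _ zero_in_E] assms by simp

text \<open>Multiplication by p is V F, and both factors are injective: V is a shift, F the
  injective Frobenius on components.\<close>

lemma W_p_torsion_free:
  assumes "w \<in> carrier W" "[p] \<cdot>\<^bsub>W\<^esub> w = \<zero>\<^bsub>W\<^esub>"
  shows "w = \<zero>\<^bsub>W\<^esub>"
proof -
  have "V (F w) = V \<zero>\<^bsub>W\<^esub>"
    using assms by (auto simp: versch_frob) (auto simp: witt_zero versch_def split: nat.split)
  then have "F w = \<zero>\<^bsub>W\<^esub>" by (rule versch_inj)
  then have "w n [^] p = \<zero>" for n by (simp add: witt_frob_def witt_zero fun_eq_iff)
  then show ?thesis using assms frobenius_inj by (auto simp: witt_zero)
qed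

lemma W_p_cancel:
  assumes "a \<in> carrier W" "b \<in> carrier W" "[p] \<cdot>\<^bsub>W\<^esub> a = [p] \<cdot>\<^bsub>W\<^esub> b"
  shows "a = b"
proof -
  have "[p] \<cdot>\<^bsub>W\<^esub> (a \<ominus>\<^bsub>W\<^esub> b) \<oplus>\<^bsub>W\<^esub> [p] \<cdot>\<^bsub>W\<^esub> b = [p] \<cdot>\<^bsub>W\<^esub> a"
    using assms(1,2) by (simp flip: W.add.nat_pow_distrib add: a_minus_def W.a_assoc W.l_neg)
  then have "[p] \<cdot>\<^bsub>W\<^esub> (a \<ominus>\<^bsub>W\<^esub> b) = \<zero>\<^bsub>W\<^esub>"
    using assms by (simp add: W.minus_closed)
  then show ?thesis using W_p_torsion_free assms W.r_right_minus_eq by (metis W.minus_closed)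
qed

section \<open>Sums of Teichmueller lifts of \<open>p\<close>-monomials\<close>

lemma mem_M: "m \<in> M \<longleftrightarrow> (\<exists>b\<in>carrier R. \<exists>e\<in>E. m = b [^] p \<otimes> v e)"
  unfolding p_monomials_def E_def by blast

lemma M_subset: "M \<subseteq> carrier R"
  by (auto simp: mem_M)

lemma pth_power_in_M: "a \<in> carrier R \<Longrightarrow> a [^] p \<in> M"
  unfolding mem_M using zero_in_E v_zero by (intro bexI[of _ a] bexI[of _ "\<lambda>i\<in>{1..N}. 0"]) simp_all

lemma v_mult:
  assumes "e \<in> E" "e' \<in> E"
  obtains b e'' where "b \<in> carrier R" "e'' \<in> E" "v e \<otimes> v e' = b [^] p \<otimes> v e''"
proof -
  \<comment> \<open>Exponents are added with carry: the remainder modulo p stays in the monomial,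
    the quotient moves into the p-th power.\<close>
  define b where "b = (\<Otimes>j\<in>{1..N}. x j [^] ((e j + e' j) div p))"
  define e'' where "e'' = (\<lambda>j\<in>{1..N}. (e j + e' j) mod p)"
  have x: "x j \<in> carrier R" if "j \<in> {1..N}" for j using x_closed that by auto
  have pows: "x j [^] e j \<otimes> x j [^] e' j = (x j [^] ((e j + e' j) div p)) [^] p \<otimes> x j [^] e'' j"
    if "j \<in> {1..N}" for j
    using x[OF that] that by (simp add: nat_pow_mult nat_pow_pow e''_def)
  have "v e \<otimes> v e' = (\<Otimes>j\<in>{1..N}. x j [^] e j \<otimes> x j [^] e' j)"
    unfolding frob_monomial_def by (rule finprod_multf[symmetric]) (auto simp: x)
  also have "\<dots> = (\<Otimes>j\<in>{1..N}. (x j [^] ((e j + e' j) div p)) [^] p \<otimes> x j [^] e'' j)"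
    using x by (intro finprod_cong refl) (auto simp: pows simp_implies_def)
  also have "\<dots> = (\<Otimes>j\<in>{1..N}. (x j [^] ((e j + e' j) div p)) [^] p) \<otimes> v e''"
    unfolding frob_monomial_def by (rule finprod_multf) (auto simp: x)
  also have "(\<Otimes>j\<in>{1..N}. (x j [^] ((e j + e' j) div p)) [^] p) = b [^] p"
    unfolding b_def by (rule finprod_nat_pow[symmetric]) (auto simp: x)
  finally have "v e \<otimes> v e' = b [^] p \<otimes> v e''" .
  moreover have "e'' \<in> E"
    using p_pos mod_less_divisor[OF p_pos] by (auto simp: E_def e''_def less_Suc_eq_le[symmetric])
  moreover have "b \<in> carrier R" unfolding b_def by (rule finprod_closed) (auto simp: x)
  ultimately show thesis using that by blast
qed

lemma M_mult:
  assumes "m \<in> M" "m' \<in> M"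
  shows "m \<otimes> m' \<in> M"
proof -
  from assms obtain b e b' e' where *: "b \<in> carrier R" "e \<in> E" "m = b [^] p \<otimes> v e"
    "b' \<in> carrier R" "e' \<in> E" "m' = b' [^] p \<otimes> v e'" unfolding mem_M by blast
  obtain c e'' where c: "c \<in> carrier R" "e'' \<in> E" "v e \<otimes> v e' = c [^] p \<otimes> v e''"
    using v_mult *(2,5) .
  have "m \<otimes> m' = (b \<otimes> b') [^] p \<otimes> (v e \<otimes> v e')"
    using * by (simp add: nat_pow_distrib m_ac)
  also have "\<dots> = (b \<otimes> b' \<otimes> c) [^] p \<otimes> v e''"
    using * c by (simp add: nat_pow_distrib m_assoc)
  finally show ?thesis using * c unfolding mem_M by blast
qed

text \<open>Normal form of the elements of \<open>S\<close>, with one summand per basis element; it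
  makes coefficients comparable.\<close>

definition monsum :: "((nat \<Rightarrow> nat) \<Rightarrow> 'a) \<Rightarrow> (nat \<Rightarrow> 'a) set" where
  "monsum b = (\<Oplus>\<^bsub>B\<^esub>e\<in>E. \<tau> (b e [^] p \<otimes> v e))"

lemma monsum_add:
  assumes "b \<in> E \<rightarrow> carrier R" "c \<in> E \<rightarrow> carrier R"
  shows "monsum b \<oplus>\<^bsub>B\<^esub> monsum c = monsum (\<lambda>e. b e \<oplus> c e)"
proof -
  have "\<tau> (b e [^] p \<otimes> v e) \<oplus>\<^bsub>B\<^esub> \<tau> (c e [^] p \<otimes> v e) = \<tau> ((b e \<oplus> c e) [^] p \<otimes> v e)"
    if "e \<in> E" for e
  proof -
    have "b e \<in> carrier R" "c e \<in> carrier R" using assms that by auto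
    then show ?thesis by (simp add: \<tau>_mult q.S.l_distr flip: \<tau>_frob_add)
  qed
  moreover have "monsum b \<oplus>\<^bsub>B\<^esub> monsum c =
      (\<Oplus>\<^bsub>B\<^esub>e\<in>E. \<tau> (b e [^] p \<otimes> v e) \<oplus>\<^bsub>B\<^esub> \<tau> (c e [^] p \<otimes> v e))"
    unfolding monsum_def using assms by (intro q.S.finsum_addf[symmetric]) (auto simp: Pi_def)
  moreover have "(\<lambda>e. \<tau> ((b e \<oplus> c e) [^] p \<otimes> v e)) \<in> E \<rightarrow> carrier B"
    using assms by (simp add: Pi_def)
  ultimately show ?thesis
    unfolding monsum_def[of "\<lambda>e. b e \<oplus> c e"] by (simp cong: q.S.finsum_cong')
qed

lemma monsum_zero:
  assumes "\<And>e. e \<in> E \<Longrightarrow> b e = \<zero>"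
  shows "monsum b = \<zero>\<^bsub>B\<^esub>"
  unfolding monsum_def using assms p_pos
  by (intro q.S.add.finprod_one_eqI) (simp add: nat_pow_zero \<tau>_zero)

lemma monsum_single:
  assumes "a \<in> carrier R" "e \<in> E"
  shows "\<tau> (a [^] p \<otimes> v e) \<in> monsum ` (E \<rightarrow> carrier R)"
proof -
  have "(\<Oplus>\<^bsub>B\<^esub>e'\<in>E. if e = e' then \<tau> (a [^] p \<otimes> v e') else \<zero>\<^bsub>B\<^esub>) = \<tau> (a [^] p \<otimes> v e)"
    using assms finite_E by (intro q.S.finsum_singleton) auto
  moreover have "(if e = e' then \<tau> (a [^] p \<otimes> v e') else \<zero>\<^bsub>B\<^esub>) =
      \<tau> ((if e = e' then a else \<zero>) [^] p \<otimes> v e')" for e'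
    using p_pos by (simp add: nat_pow_zero \<tau>_zero)
  ultimately have "\<tau> (a [^] p \<otimes> v e) = monsum (\<lambda>e'. if e = e' then a else \<zero>)"
    unfolding monsum_def by simp
  moreover have "(\<lambda>e'. if e = e' then a else \<zero>) \<in> E \<rightarrow> carrier R" using assms by simp
  ultimately show ?thesis by (rule image_eqI)
qed

lemma S_eq_monsum: "S = monsum ` (E \<rightarrow> carrier R)"
proof (intro equalityI subsetI)
  fix s assume "s \<in> S"
  then obtain k m where m: "m \<in> {..<k} \<rightarrow> M" and s: "s = (\<Oplus>\<^bsub>B\<^esub>i\<in>{..<k::nat}. \<tau> (m i))"
    unfolding p_monomial_teich_sums_def by blast
  show "s \<in> monsum ` (E \<rightarrow> carrier R)"
    unfolding s
  proof (rule q.S.finsum_in_additive_closed)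
    fix i assume "i \<in> {..<k}"
    then have "m i \<in> M" using m by auto
    then obtain a e where "a \<in> carrier R" "e \<in> E" "m i = a [^] p \<otimes> v e"
      unfolding mem_M by blast
    then show "\<tau> (m i) \<in> monsum ` (E \<rightarrow> carrier R)"
      using monsum_single by metis
  next
    show "monsum ` (E \<rightarrow> carrier R) \<subseteq> carrier B"
      unfolding monsum_def by (auto intro!: q.S.finsum_closed simp: Pi_def)
    show "\<zero>\<^bsub>B\<^esub> \<in> monsum ` (E \<rightarrow> carrier R)"
      using monsum_zero[of "\<lambda>_. \<zero>"] by (intro image_eqI[of _ _ "\<lambda>_. \<zero>"]) auto
    show "a \<oplus>\<^bsub>B\<^esub> b \<in> monsum ` (E \<rightarrow> carrier R)"
      if "a \<in> monsum ` (E \<rightarrow> carrier R)" "b \<in> monsum ` (E \<rightarrow> carrier R)" for a b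
    proof -
      from that obtain c d where "a = monsum c" "b = monsum d" "c \<in> E \<rightarrow> carrier R" "d \<in> E \<rightarrow> carrier R"
        by blast
      then show ?thesis by (intro image_eqI[of _ _ "\<lambda>e. c e \<oplus> d e"]) (auto simp: monsum_add Pi_def)
    qed
  qed simp
next
  fix s assume "s \<in> monsum ` (E \<rightarrow> carrier R)"
  then obtain b where b: "b \<in> E \<rightarrow> carrier R" and s: "s = monsum b" by blast
  obtain h where h: "bij_betw h {..<card E} E"
    using ex_bij_betw_nat_finite[OF finite_E] by (auto simp: atLeast0LessThan)
  then have hE: "h ` {..<card E} = E" "inj_on h {..<card E}" by (auto simp: bij_betw_def)
  have "s = (\<Oplus>\<^bsub>B\<^esub>e\<in>h ` {..<card E}. \<tau> (b e [^] p \<otimes> v e))"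
    unfolding s monsum_def hE ..
  also have "\<dots> = (\<Oplus>\<^bsub>B\<^esub>i\<in>{..<card E}. \<tau> (b (h i) [^] p \<otimes> v (h i)))"
    using b hE by (intro q.S.finsum_reindex) (auto simp: Pi_def)
  finally have "s = (\<Oplus>\<^bsub>B\<^esub>i\<in>{..<card E}. \<tau> (b (h i) [^] p \<otimes> v (h i)))" .
  moreover have "(\<lambda>i. b (h i) [^] p \<otimes> v (h i)) \<in> {..<card E} \<rightarrow> M"
  proof (rule Pi_I)
    fix i assume "i \<in> {..<card E}"
    then have "h i \<in> E" using hE by blast
    moreover from this have "b (h i) \<in> carrier R" using b by blast
    ultimately show "b (h i) [^] p \<otimes> v (h i) \<in> M" unfolding mem_M by blast
  qed
  ultimately show "s \<in> S" unfolding p_monomial_teich_sums_def mem_Collect_eq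
    by (intro exI[of _ "card E"] exI[of _ "\<lambda>i. b (h i) [^] p \<otimes> v (h i)"] conjI)
qed

lemma S_subset: "S \<subseteq> carrier B"
  unfolding S_eq_monsum monsum_def by (auto intro!: q.S.finsum_closed simp: Pi_def)

lemma S_zero: "\<zero>\<^bsub>B\<^esub> \<in> S"
  unfolding S_eq_monsum
  using monsum_zero[of "\<lambda>_. \<zero>"] by (intro image_eqI[of _ _ "\<lambda>_. \<zero>"]) auto

lemma S_add:
  assumes "a \<in> S" "b \<in> S"
  shows "a \<oplus>\<^bsub>B\<^esub> b \<in> S"
proof -
  from assms obtain c d where "a = monsum c" "b = monsum d" "c \<in> E \<rightarrow> carrier R" "d \<in> E \<rightarrow> carrier R"
    unfolding S_eq_monsum by blast
  then show ?thesis unfolding S_eq_monsum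
    by (intro image_eqI[of _ _ "\<lambda>e. c e \<oplus> d e"]) (auto simp: monsum_add Pi_def)
qed

lemma S_finsum: "finite A \<Longrightarrow> (\<And>i. i \<in> A \<Longrightarrow> f i \<in> S) \<Longrightarrow> (\<Oplus>\<^bsub>B\<^esub>i\<in>A. f i) \<in> S"
  by (rule q.S.finsum_in_additive_closed[OF _ _ S_subset S_zero S_add])

lemma \<tau>_in_S: "m \<in> M \<Longrightarrow> \<tau> m \<in> S"
  unfolding S_eq_monsum mem_M using monsum_single by blast

lemma S_E:
  assumes "s \<in> S"
  obtains k m where "m \<in> {..<k::nat} \<rightarrow> M" "s = (\<Oplus>\<^bsub>B\<^esub>i\<in>{..<k}. \<tau> (m i))"
  using assms unfolding p_monomial_teich_sums_def by blast

lemma S_mult: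
  assumes "s \<in> S" "t \<in> S"
  shows "s \<otimes>\<^bsub>B\<^esub> t \<in> S"
proof -
  obtain k m where m: "m \<in> {..<k} \<rightarrow> M" and s: "s = (\<Oplus>\<^bsub>B\<^esub>i\<in>{..<k::nat}. \<tau> (m i))"
    using S_E assms(1) .
  obtain l n where n: "n \<in> {..<l} \<rightarrow> M" and t: "t = (\<Oplus>\<^bsub>B\<^esub>i\<in>{..<l::nat}. \<tau> (n i))"
    using S_E assms(2) .
  have M_c: "m i \<in> carrier R" "n j \<in> carrier R" if "i < k" "j < l" for i j
    using m n M_subset that by auto
  have [simp]: "\<tau> (m i) \<in> carrier B" if "i < k" for i
    using m M_subset that by (auto intro!: \<tau>_closed)
  have tB: "t \<in> carrier B" using assms S_subset by auto
  have "\<tau> (m i) \<otimes>\<^bsub>B\<^esub> t \<in> S" if i: "i < k" for i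
  proof -
    have "\<tau> (m i) \<otimes>\<^bsub>B\<^esub> t = (\<Oplus>\<^bsub>B\<^esub>j\<in>{..<l}. \<tau> (m i) \<otimes>\<^bsub>B\<^esub> \<tau> (n j))"
      unfolding t using M_c[OF i] i by (intro q.S.finsum_rdistr) (auto simp: Pi_def)
    also have "\<dots> \<in> S"
    proof (rule S_finsum)
      fix j assume j: "j \<in> {..<l}"
      then have "m i \<otimes> n j \<in> M" using m n i by (auto intro!: M_mult)
      then show "\<tau> (m i) \<otimes>\<^bsub>B\<^esub> \<tau> (n j) \<in> S" using \<tau>_in_S M_c i j by (auto simp flip: \<tau>_mult)
    qed simp
    finally show ?thesis .
  qed
  moreover have "s \<otimes>\<^bsub>B\<^esub> t = (\<Oplus>\<^bsub>B\<^esub>i\<in>{..<k}. \<tau> (m i) \<otimes>\<^bsub>B\<^esub> t)"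
    unfolding s using tB by (intro q.S.finsum_ldistr) (auto simp: Pi_def)
  ultimately show ?thesis by (auto intro!: S_finsum)
qed

lemma S_nat_mult: "s \<in> S \<Longrightarrow> [k] \<cdot>\<^bsub>B\<^esub> s \<in> S" for k :: nat
  using S_subset by (induction k) (auto simp: S_zero intro: S_add)

lemma S_subring: "subring S B"
proof (rule q.S.subringI)
  show "\<one>\<^bsub>B\<^esub> \<in> S" using \<tau>_in_S[OF pth_power_in_M[of \<one>]] by (simp add: \<tau>_one)
  fix s assume s: "s \<in> S"
  then have sB: "s \<in> carrier B" using S_subset by auto
  \<comment> \<open>As p annihilates W(R)/p, negatives are (p-1)-fold sums, and signs of p-monomials
    need no separate argument.\<close>
  have "Suc (p - 1) = p" using p_pos by simp
  then have "[(p - 1)] \<cdot>\<^bsub>B\<^esub> s \<oplus>\<^bsub>B\<^esub> s = \<zero>\<^bsub>B\<^esub>"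
    using p_mult_B[OF sB] q.S.add.nat_pow_Suc[of "p - 1" s] sB by simp
  then have "\<ominus>\<^bsub>B\<^esub> s = [(p - 1)] \<cdot>\<^bsub>B\<^esub> s" using sB by (intro q.S.minus_equality) auto
  then show "\<ominus>\<^bsub>B\<^esub> s \<in> S" using S_nat_mult[OF s] by simp
qed (use S_subset S_mult S_add in auto)

text \<open>The zeroth component of a normal form is an expansion in the basis; if it vanishes, so
  do all coefficients. This is the source of the uniqueness in \<open>Delta_W\<close>.\<close>

lemma S_inter_versch:
  assumes "w \<in> carrier W" "q w \<in> S" "w 0 = \<zero>"
  shows "q w = \<zero>\<^bsub>B\<^esub>"
proof -
  from assms obtain b where b: "b \<in> E \<rightarrow> carrier R" "q w = monsum b" unfolding S_eq_monsum by blast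
  define y where "y = (\<Oplus>\<^bsub>W\<^esub>e\<in>E. T (b e [^] p \<otimes> v e))"
  have Tc: "(\<lambda>e. T (b e [^] p \<otimes> v e)) \<in> E \<rightarrow> carrier W" using b by (auto simp: Pi_def)
  have "q y = q w" using b Tc unfolding y_def monsum_def by (simp add: comp_def \<tau>_def)
  then have "y 0 = \<zero>" using component0_cong[of y w] assms Tc unfolding y_def by simp
  then have "(\<Oplus>e\<in>E. b e [^] p \<otimes> v e) = \<zero>" using Tc unfolding y_def by (simp add: comp_def)
  then have "b e = \<zero>" if "e \<in> E" for e using expansion_zero b that by blast
  then show ?thesis using b monsum_zero by simp
qed

section \<open>The operator \<open>\<Delta>\<close>\<close>

lemma Delta_W_eqI:
  assumes "s \<in> S" "d \<in> carrier W" "\<alpha> = s \<oplus>\<^bsub>B\<^esub> q (V d)"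
  shows "Delta_W R p N x \<alpha> = C (q d)"
  unfolding Delta_W_def
proof (rule the_equality, intro conjI)
  have sB: "s \<in> carrier B" using assms S_subset by auto
  show "C (q d) \<in> carrier (Wcoker R p)" using assms by (simp add: carrier_Wcoker)
  show "\<alpha> \<ominus>\<^bsub>B\<^esub> Wcoker_versch R p (C (q d)) \<in> S"
    using assms sB by (simp add: Wcoker_versch_C a_minus_def q.S.a_assoc q.S.r_neg)
  fix D assume D: "D \<in> carrier (Wcoker R p) \<and> \<alpha> \<ominus>\<^bsub>B\<^esub> Wcoker_versch R p D \<in> S"
  then obtain d' where d': "d' \<in> carrier W" "D = C (q d')"
    using carrier_Wcoker carrier_B by auto
  then have t: "\<alpha> \<ominus>\<^bsub>B\<^esub> q (V d') \<in> S" using D by (simp add: Wcoker_versch_C)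
  let ?w = "d' \<ominus>\<^bsub>W\<^esub> d"
  have w: "?w \<in> carrier W" using d' assms by simp
  have "V d' = V (?w \<oplus>\<^bsub>W\<^esub> d)"
    using d' assms by (simp add: a_minus_def W.a_assoc W.l_neg)
  then have Vw: "V d' = V ?w \<oplus>\<^bsub>W\<^esub> V d" using versch_add w assms by simp
  have "q (V ?w) = s \<oplus>\<^bsub>B\<^esub> \<ominus>\<^bsub>B\<^esub> (\<alpha> \<ominus>\<^bsub>B\<^esub> q (V d'))"
    unfolding Vw using w assms sB d'
    by (simp add: a_minus_def q.S.minus_add q.S.a_ac q.S.r_neg q.S.l_neg) 
      (simp add: q.S.a_ac q.S.r_neg2 q.S.r_neg1)
  also have "\<dots> \<in> S"
    using t assms(1) subringE(5)[OF S_subring] subringE(7)[OF S_subring] by blast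
  finally have "q (V ?w) = \<zero>\<^bsub>B\<^esub>" using w by (intro S_inter_versch) auto
  \<comment> \<open>From V w = p c = V (F c) follows w = F c, whose class is [c_0^p] and dies in the
    cokernel.\<close>
  then obtain c where c: "c \<in> carrier W" "V ?w = [p] \<cdot>\<^bsub>W\<^esub> c"
    using q_eq_zeroE w versch_closed by metis
  then have "?w = F c" by (simp add: versch_inj flip: versch_frob)
  then have "d' = F c \<oplus>\<^bsub>W\<^esub> d" using d' assms by (metis w W.a_assoc W.l_neg W.r_zero W.a_inv_closed a_minus_def)
  then have "q d' = \<tau> (c 0 [^] p) \<oplus>\<^bsub>B\<^esub> q d" using c assms by (simp add: q_frob)
  then show "D = C (q d)" using c d' assms by (simp add: C_frob_add)
qed

text \<open>Another representative differs by some [r^p], itself the lift of a p-monomial, so it is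
  absorbed into s.\<close>

lemma Delta_W_bar_eqI:
  assumes "s \<in> S" "d \<in> carrier W" "\<alpha> = s \<oplus>\<^bsub>B\<^esub> q (V d)"
  shows "Delta_W_bar R p N x (C \<alpha>) = C (q d)"
  unfolding Delta_W_bar_def
proof (rule the_elem_image_const[OF C_self])
  have sB: "s \<in> carrier B" using assms S_subset by auto
  then show "\<alpha> \<in> carrier B" using assms by simp
  fix \<beta> assume "\<beta> \<in> C \<alpha>"
  then obtain r where r: "r \<in> carrier R" "\<beta> = \<tau> (r [^] p) \<oplus>\<^bsub>B\<^esub> \<alpha>" by (auto simp: mem_C)
  then have "\<beta> = (\<tau> (r [^] p) \<oplus>\<^bsub>B\<^esub> s) \<oplus>\<^bsub>B\<^esub> q (V d)"
    using assms sB by (simp add: q.S.a_assoc)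
  moreover have "\<tau> (r [^] p) \<oplus>\<^bsub>B\<^esub> s \<in> S" using r assms by (intro S_add \<tau>_in_S pth_power_in_M) auto
  ultimately show "Delta_W R p N x \<beta> = C (q d)" using Delta_W_eqI assms by blast
qed

end

section \<open>The congruence for D and its iteration\<close>

context p_basis_ring
begin

text \<open>Since [m]^p = F [m] for a single lift, each added summand only creates p times mixed
  terms. Divided by p, these are integer polynomials in the lifts, so their classes stay in the
  subring \<open>S\<close>.\<close>

lemma pow_p_monomial_sum:
  assumes "finite A" "m \<in> A \<rightarrow> M"
  obtains c where "c \<in> carrier W" "q c \<in> S"
    "(\<Oplus>\<^bsub>W\<^esub>e\<in>A. T (m e)) [^]\<^bsub>W\<^esub> p = F (\<Oplus>\<^bsub>W\<^esub>e\<in>A. T (m e)) \<oplus>\<^bsub>W\<^esub> [p] \<cdot>\<^bsub>W\<^esub> c"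
proof -
  note sub = subringE[OF S_subring]
  have pow_in: "s [^]\<^bsub>B\<^esub> k \<in> S" if "s \<in> S" for s and k :: nat
    using that sub by (induction k) auto
  \<comment> \<open>Membership of the partial sum in \<open>S\<close> is carried along, since the
    cofactor of the next expansion is a polynomial in that sum.\<close>
  have "\<exists>c\<in>carrier W. q c \<in> S \<and> q (\<Oplus>\<^bsub>W\<^esub>e\<in>A. T (m e)) \<in> S \<and>
    (\<Oplus>\<^bsub>W\<^esub>e\<in>A. T (m e)) [^]\<^bsub>W\<^esub> p = F (\<Oplus>\<^bsub>W\<^esub>e\<in>A. T (m e)) \<oplus>\<^bsub>W\<^esub> [p] \<cdot>\<^bsub>W\<^esub> c"
    using assms
  proof (induction A)
    case empty
    show ?case using sub p_pos by (intro bexI[of _ "\<zero>\<^bsub>W\<^esub>"]) (simp_all add: W.nat_pow_zero)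
  next
    case (insert e A)
    define y where "y = (\<Oplus>\<^bsub>W\<^esub>e\<in>A. T (m e))"
    define t where "t = T (m e)"
    have mM: "m e \<in> M" and mA: "m \<in> A \<rightarrow> M" using insert(4) by auto
    then have Tc: "(\<lambda>e. T (m e)) \<in> A \<rightarrow> carrier W" and t: "t \<in> carrier W" and m: "m e \<in> carrier R"
      using M_subset by (auto simp: t_def Pi_def)
    have y: "y \<in> carrier W" using Tc by (simp add: y_def)
    obtain c where c: "c \<in> carrier W" "q c \<in> S" "q y \<in> S" "y [^]\<^bsub>W\<^esub> p = F y \<oplus>\<^bsub>W\<^esub> [p] \<cdot>\<^bsub>W\<^esub> c"
      using insert(3)[OF mA] unfolding y_def by blast
    have tS: "q t \<in> S" using \<tau>_in_S[OF mM] by (simp add: t_def \<tau>_def)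
    have tp: "t [^]\<^bsub>W\<^esub> p = F t" using m by (simp add: t_def flip: teich_pow teich_frob)
    obtain P where P: "(y \<oplus>\<^bsub>W\<^esub> t) [^]\<^bsub>W\<^esub> p = y [^]\<^bsub>W\<^esub> p \<oplus>\<^bsub>W\<^esub>
        [p] \<cdot>\<^bsub>W\<^esub> (y [^]\<^bsub>W\<^esub> (p - 1) \<otimes>\<^bsub>W\<^esub> t) \<oplus>\<^bsub>W\<^esub>
        [p] \<cdot>\<^bsub>W\<^esub> (t [^]\<^bsub>W\<^esub> (2::nat) \<otimes>\<^bsub>W\<^esub> zpoly_eval W (\<lambda>i::bool. if i then y else t) P) \<oplus>\<^bsub>W\<^esub>
        t [^]\<^bsub>W\<^esub> p"
      using W.prime_binomial_expansion[OF prime_p y t] by metis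
    define u where "u = zpoly_eval W (\<lambda>i::bool. if i then y else t) P"
    have rng: "range (\<lambda>i::bool. if i then y else t) \<subseteq> carrier W" using y t by auto
    then have u: "u \<in> carrier W" unfolding u_def by (rule W.zpoly_eval_closed)
    have "q u = zpoly_eval B (q \<circ> (\<lambda>i::bool. if i then y else t)) P"
      unfolding u_def by (rule q.hom_zpoly_eval[OF rng])
    also have "\<dots> \<in> S"
      by (rule q.S.zpoly_eval_in_subring[OF _ S_subring]) (use y t c tS in auto)
    finally have uS: "q u \<in> S" .
    let ?c = "c \<oplus>\<^bsub>W\<^esub> (y [^]\<^bsub>W\<^esub> (p - 1) \<otimes>\<^bsub>W\<^esub> t \<oplus>\<^bsub>W\<^esub> t [^]\<^bsub>W\<^esub> (2::nat) \<otimes>\<^bsub>W\<^esub> u)"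
    have "(y \<oplus>\<^bsub>W\<^esub> t) [^]\<^bsub>W\<^esub> p = F (y \<oplus>\<^bsub>W\<^esub> t) \<oplus>\<^bsub>W\<^esub> [p] \<cdot>\<^bsub>W\<^esub> ?c"
      unfolding P u_def[symmetric] using c y t u
      by (simp add: tp W.add.nat_pow_distrib W.a_ac)
    moreover have "q ?c \<in> S"
    proof -
      have "q ?c = q c \<oplus>\<^bsub>B\<^esub> (q y [^]\<^bsub>B\<^esub> (p - 1) \<otimes>\<^bsub>B\<^esub> q t \<oplus>\<^bsub>B\<^esub> q t [^]\<^bsub>B\<^esub> (2::nat) \<otimes>\<^bsub>B\<^esub> q u)"
        using c y t u by simp
      also have "\<dots> \<in> S" by (intro S_add S_mult pow_in c tS uS)
      finally show ?thesis .
    qed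
    moreover have "q (y \<oplus>\<^bsub>W\<^esub> t) \<in> S" using y t c tS S_add by simp
    moreover have "(\<Oplus>\<^bsub>W\<^esub>e\<in>insert e A. T (m e)) = y \<oplus>\<^bsub>W\<^esub> t"
      using insert(1,2) Tc t by (simp add: y_def t_def W.a_comm)
    moreover have "?c \<in> carrier W" using c y t u by simp
    ultimately show ?case by (intro bexI[of _ ?c]) simp_all
  qed
  then show thesis using that by blast
qed

lemma teich_expansion:
  assumes f: "f \<in> carrier R"
  obtains s D c where "s \<in> S" "D \<in> carrier W" "\<tau> f = s \<oplus>\<^bsub>B\<^esub> q (V D)"
    "c \<in> S" "q D = c \<oplus>\<^bsub>B\<^esub> q (V (T (f [^] (p ^ 2 - p)) \<otimes>\<^bsub>W\<^esub> D))"
proof -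
  obtain b where b: "b \<in> E \<rightarrow> carrier R" "f = (\<Oplus>e\<in>E. b e [^] p \<otimes> v e)"
    using ex_expansion[OF f] .
  define m where "m = (\<lambda>e. b e [^] p \<otimes> v e)"
  have mM: "m \<in> E \<rightarrow> M" unfolding m_def Pi_iff mem_M using b(1) by blast
  then have mc: "m \<in> E \<rightarrow> carrier R" using M_subset by auto
  define y where "y = (\<Oplus>\<^bsub>W\<^esub>e\<in>E. T (m e))"
  have Tc: "(\<lambda>e. T (m e)) \<in> E \<rightarrow> carrier W" using mc by (auto simp: Pi_def)
  then have y: "y \<in> carrier W" by (simp add: y_def)
  have y0: "y 0 = f" using Tc b unfolding y_def m_def by (simp add: comp_def)
  have qy: "q y = (\<Oplus>\<^bsub>B\<^esub>e\<in>E. \<tau> (m e))" using Tc unfolding y_def by (simp add: comp_def \<tau>_def)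
  have yS: "q y \<in> S" unfolding qy using mM by (auto intro!: S_finsum finite_E \<tau>_in_S)
  have "(T f \<ominus>\<^bsub>W\<^esub> y) 0 = \<zero>" using f y y0 by (simp add: a_minus_def r_neg)
  then obtain D where D: "D \<in> carrier W" "T f \<ominus>\<^bsub>W\<^esub> y = V D"
    using component0_zero_versch[of "T f \<ominus>\<^bsub>W\<^esub> y"] f y W.minus_closed teich_closed by metis
  have Tf: "T f = y \<oplus>\<^bsub>W\<^esub> V D"
    unfolding D(2)[symmetric] using f y by (simp add: a_minus_def W.a_ac W.r_neg2)
      (metis W.a_lcomm W.r_neg W.r_zero W.a_inv_closed teich_closed)
  have VD: "V D \<in> carrier W" using D by simp
  obtain c where c: "c \<in> carrier W" "q c \<in> S" "y [^]\<^bsub>W\<^esub> p = F y \<oplus>\<^bsub>W\<^esub> [p] \<cdot>\<^bsub>W\<^esub> c"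
    using pow_p_monomial_sum[OF finite_E mM] unfolding y_def by metis
  obtain P where P: "(y \<oplus>\<^bsub>W\<^esub> V D) [^]\<^bsub>W\<^esub> p = y [^]\<^bsub>W\<^esub> p \<oplus>\<^bsub>W\<^esub>
      [p] \<cdot>\<^bsub>W\<^esub> (y [^]\<^bsub>W\<^esub> (p - 1) \<otimes>\<^bsub>W\<^esub> V D) \<oplus>\<^bsub>W\<^esub>
      [p] \<cdot>\<^bsub>W\<^esub> (V D [^]\<^bsub>W\<^esub> (2::nat) \<otimes>\<^bsub>W\<^esub> zpoly_eval W (\<lambda>i::bool. if i then y else V D) P) \<oplus>\<^bsub>W\<^esub>
      V D [^]\<^bsub>W\<^esub> p"
    using W.prime_binomial_expansion[OF prime_p y VD] by metis
  define u where "u = zpoly_eval W (\<lambda>i::bool. if i then y else V D) P"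
  have u: "u \<in> carrier W" unfolding u_def using y VD by (intro W.zpoly_eval_closed) auto
  define z where "z = [(p ^ (p - 2))] \<cdot>\<^bsub>W\<^esub> V (D [^]\<^bsub>W\<^esub> p)"
  have z: "z \<in> carrier W" "q z = \<zero>\<^bsub>B\<^esub>" "V D [^]\<^bsub>W\<^esub> p = [p] \<cdot>\<^bsub>W\<^esub> z"
    unfolding z_def using D(1) q_versch_pow_p versch_pow_p by simp_all
  define r where "r = y [^]\<^bsub>W\<^esub> (p - 1) \<otimes>\<^bsub>W\<^esub> V D"
  define w where "w = V D [^]\<^bsub>W\<^esub> (2::nat) \<otimes>\<^bsub>W\<^esub> u"
  have rw: "r \<in> carrier W" "w \<in> carrier W" using y VD u by (simp_all add: r_def w_def)
  \<comment> \<open>F is applied to [f] = y + V D: F V = p produces p D on one side, while F [f] =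
    [f]^p is expanded on the other.\<close>
  have "F y \<oplus>\<^bsub>W\<^esub> [p] \<cdot>\<^bsub>W\<^esub> D = F (T f)" using Tf y D by (simp add: frob_versch)
  also have "\<dots> = T f [^]\<^bsub>W\<^esub> p" using f by (simp flip: teich_pow teich_frob)
  also have "\<dots> = F y \<oplus>\<^bsub>W\<^esub> [p] \<cdot>\<^bsub>W\<^esub> (c \<oplus>\<^bsub>W\<^esub> (r \<oplus>\<^bsub>W\<^esub> (w \<oplus>\<^bsub>W\<^esub> z)))"
    unfolding Tf P u_def[symmetric] r_def[symmetric] w_def[symmetric] c(3) z(3)
    using y c(1) rw z(1) by (simp add: W.add.nat_pow_distrib W.a_assoc)
  finally have "F y \<oplus>\<^bsub>W\<^esub> [p] \<cdot>\<^bsub>W\<^esub> D = F y \<oplus>\<^bsub>W\<^esub> [p] \<cdot>\<^bsub>W\<^esub> (c \<oplus>\<^bsub>W\<^esub> (r \<oplus>\<^bsub>W\<^esub> (w \<oplus>\<^bsub>W\<^esub> z)))" .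
  from arg_cong[OF this, of "\<lambda>t. \<ominus>\<^bsub>W\<^esub> F y \<oplus>\<^bsub>W\<^esub> t"] have "[p] \<cdot>\<^bsub>W\<^esub> D = [p] \<cdot>\<^bsub>W\<^esub> (c \<oplus>\<^bsub>W\<^esub> (r \<oplus>\<^bsub>W\<^esub> (w \<oplus>\<^bsub>W\<^esub> z)))"
    using y D(1) c(1) rw z(1) by (simp only: W.r_neg1 frob_closed W.add.nat_pow_closed W.a_closed)
  then have Deq: "D = c \<oplus>\<^bsub>W\<^esub> (r \<oplus>\<^bsub>W\<^esub> (w \<oplus>\<^bsub>W\<^esub> z))"
    by (rule W_p_cancel[OF D(1), rotated]) (use c(1) rw z(1) in simp)
  \<comment> \<open>(V D)^2 contains a factor p besides the one just cancelled, so w vanishes modulo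
    p.\<close>
  have "V D [^]\<^bsub>W\<^esub> (2::nat) = [p] \<cdot>\<^bsub>W\<^esub> V (D \<otimes>\<^bsub>W\<^esub> D)"
    using D(1) VD by (simp add: numeral_2_eq_2 versch_mult)
  then have qw: "q w = \<zero>\<^bsub>B\<^esub>"
    unfolding w_def using D(1) u by (simp add: q_p_mult)
  let ?g = "f [^] (p ^ 2 - p)"
  \<comment> \<open>The zeroth component of y is f, so F y has class [f^p]; its (p-1)-st power
    explains the exponent p^2 - p.\<close>
  have "q (F y [^]\<^bsub>W\<^esub> (p - 1) \<otimes>\<^bsub>W\<^esub> D) = \<tau> (f [^] p) [^]\<^bsub>B\<^esub> (p - 1) \<otimes>\<^bsub>B\<^esub> q D"
    using y D(1) by (simp add: q_frob y0)
  also have "\<tau> (f [^] p) [^]\<^bsub>B\<^esub> (p - 1) = q (T ((f [^] p) [^] (p - 1)))"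
    using f by (simp add: \<tau>_def teich_pow)
  also have "(f [^] p) [^] (p - 1) = ?g"
    using f by (simp add: nat_pow_pow power2_eq_square right_diff_distrib')
  finally have "q (F y [^]\<^bsub>W\<^esub> (p - 1) \<otimes>\<^bsub>W\<^esub> D) = q (T ?g \<otimes>\<^bsub>W\<^esub> D)"
    using f D(1) by simp
  then have "q (V (F y [^]\<^bsub>W\<^esub> (p - 1) \<otimes>\<^bsub>W\<^esub> D)) = q (V (T ?g \<otimes>\<^bsub>W\<^esub> D))"
    using f y D(1) by (intro q_versch_cong) auto
  moreover have "r = V (F y [^]\<^bsub>W\<^esub> (p - 1) \<otimes>\<^bsub>W\<^esub> D)"
    unfolding r_def using y D(1) by (simp add: mult_versch)
  ultimately have qr: "q r = q (V (T ?g \<otimes>\<^bsub>W\<^esub> D))" by simp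
  have "q D = q c \<oplus>\<^bsub>B\<^esub> q r"
    by (subst Deq) (use c(1) rw z qw in simp)
  then have "q D = q c \<oplus>\<^bsub>B\<^esub> q (V (T ?g \<otimes>\<^bsub>W\<^esub> D))" unfolding qr .
  moreover have "\<tau> f = q y \<oplus>\<^bsub>B\<^esub> q (V D)" unfolding \<tau>_def Tf using y VD by simp
  ultimately show thesis using that yS D(1) c(2) by blast
qed

text \<open>One d serves every k, namely the zeroth component of a representative D of the first
  iterate. Comparison with k = 0, where the exponent is 0, then gives the theorem.\<close>

lemma Delta_eq:
  assumes f: "f \<in> carrier R" 
  obtains d where "d \<in> carrier R"
    "\<And>k. Delta R p N x (Suc k) f = frob_image R p +> (f [^] (p ^ Suc k - p) \<otimes> d)"
proof -
  obtain s D c where s: "s \<in> S" and D: "D \<in> carrier W" and sD: "\<tau> f = s \<oplus>\<^bsub>B\<^esub> q (V D)"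
    and c: "c \<in> S" and cD: "q D = c \<oplus>\<^bsub>B\<^esub> q (V (T (f [^] (p ^ 2 - p)) \<otimes>\<^bsub>W\<^esub> D))"
    using teich_expansion[OF f] .
  have cB: "c \<in> carrier B" using c S_subset by auto
  have iter: "(Delta_W_bar R p N x ^^ Suc k) (C (\<tau> f)) = C (q (T (f [^] (p ^ Suc k - p)) \<otimes>\<^bsub>W\<^esub> D))" for k
  proof (induction k)
    case 0
    show ?case using Delta_W_bar_eqI[OF s D sD] D by (simp flip: witt_one)
  next
    case (Suc k)
    \<comment> \<open>As p^(k+1) - p = p (p^k - 1), the multiplier is a p-th power g^p, hence a
      p-monomial, and multiplication by its lift preserves \<open>S\<close>.\<close>
    define g where "g = f [^] (p ^ k - 1)"
    have g: "g \<in> carrier R" using f by (simp add: g_def)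
    have gp: "g [^] p = f [^] (p ^ Suc k - p)"
      unfolding g_def using f by (simp add: nat_pow_pow right_diff_distrib' mult.commute)
    let ?G = "f [^] (p ^ 2 - p)" and ?H = "f [^] (p ^ Suc (Suc k) - p)"
    \<comment> \<open>Moving [g^p] inside V raises g^p to its p-th power, which gives the recursion
      of exponents; the truncated subtractions require both inequalities.\<close>
    have "p * p ^ Suc k - p * p + (p * p - p) = p * p ^ Suc k - p"
    proof -
      have "p * p \<le> p * p ^ Suc k" "p \<le> p * p" using p_pos by simp_all
      then show ?thesis by linarith
    qed
    then have "(p ^ Suc k - p) * p + (p ^ 2 - p) = p ^ Suc (Suc k) - p"
      by (simp add: power2_eq_square left_diff_distrib' algebra_simps)
    then have exps: "(g [^] p) [^] p \<otimes> ?G = ?H"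
      unfolding gp using f by (simp add: nat_pow_pow nat_pow_mult)
    have "T (g [^] p) \<otimes>\<^bsub>W\<^esub> V (T ?G \<otimes>\<^bsub>W\<^esub> D) = V (T ((g [^] p) [^] p) \<otimes>\<^bsub>W\<^esub> (T ?G \<otimes>\<^bsub>W\<^esub> D))"
      using g f D by (simp add: mult_versch flip: teich_frob)
    also have "T ((g [^] p) [^] p) \<otimes>\<^bsub>W\<^esub> (T ?G \<otimes>\<^bsub>W\<^esub> D) = T ?H \<otimes>\<^bsub>W\<^esub> D"
      unfolding exps[symmetric] using f g D by (simp add: teich_mult W.m_assoc)
    finally have V_eq: "T (g [^] p) \<otimes>\<^bsub>W\<^esub> V (T ?G \<otimes>\<^bsub>W\<^esub> D) = V (T ?H \<otimes>\<^bsub>W\<^esub> D)" .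
    have "q (T (g [^] p) \<otimes>\<^bsub>W\<^esub> D) = \<tau> (g [^] p) \<otimes>\<^bsub>B\<^esub> (c \<oplus>\<^bsub>B\<^esub> q (V (T ?G \<otimes>\<^bsub>W\<^esub> D)))"
      using g D by (simp add: \<tau>_def flip: cD)
    also have "\<dots> = \<tau> (g [^] p) \<otimes>\<^bsub>B\<^esub> c \<oplus>\<^bsub>B\<^esub> q (T (g [^] p) \<otimes>\<^bsub>W\<^esub> V (T ?G \<otimes>\<^bsub>W\<^esub> D))"
      using f g D cB by (simp add: \<tau>_def q.S.r_distr)
    finally have "q (T (g [^] p) \<otimes>\<^bsub>W\<^esub> D) = \<tau> (g [^] p) \<otimes>\<^bsub>B\<^esub> c \<oplus>\<^bsub>B\<^esub> q (V (T ?H \<otimes>\<^bsub>W\<^esub> D))"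
      unfolding V_eq .
    then have "Delta_W_bar R p N x (C (q (T (g [^] p) \<otimes>\<^bsub>W\<^esub> D))) = C (q (T ?H \<otimes>\<^bsub>W\<^esub> D))"
      using f g D c by (intro Delta_W_bar_eqI[where s = "\<tau> (g [^] p) \<otimes>\<^bsub>B\<^esub> c"] S_mult \<tau>_in_S pth_power_in_M) auto
    then show ?case using Suc unfolding gp by simp
  qed
  have "Delta R p N x (Suc k) f = frob_image R p +> (f [^] (p ^ Suc k - p) \<otimes> D 0)" for k
    unfolding Delta_def iter using f D by (subst Wcoker_component0_C) simp_all
  then show thesis using that[of "D 0"] D by simp
qed

end

theorem theorem3p20:
  fixes R :: "('a, 'b) ring_scheme" (structure)
    and \<mm> :: "'a set"
    and p N n :: nat
    and x :: "nat \<Rightarrow> 'a"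
    and f :: 'a
  assumes "regular_local_ring R \<mm>"
    and "Factorial_Ring.prime p" and "[p] \<cdot>\<^bsub>R\<^esub> \<one>\<^bsub>R\<^esub> = \<zero>\<^bsub>R\<^esub>"
    and "F_finite R p"
    and "x \<in> {1..N} \<rightarrow> carrier R"
    and "module_basis R (frob_pushforward R p) (frob_exponents p N) (frob_monomial R N x)"
    and "n \<ge> 1"
    and "f \<in> carrier R"
  shows "Delta R p N x n f =
    frob_quot_mult R p (f [^]\<^bsub>R\<^esub> (p ^ n - p)) (Delta R p N x 1 f)"
proof -
  interpret regular_local_ring R \<mm> by fact
  interpret p_basis_ring R p N x
    by unfold_locales (use assms in simp_all)
  obtain d where d: "d \<in> carrier R"
    "\<And>k. Delta R p N x (Suc k) f = frob_image R p +> (f [^] (p ^ Suc k - p) \<otimes> d)"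
    using Delta_eq assms by blast
  obtain k where n: "n = Suc k" using assms by (cases n) auto
  \<comment> \<open>Well-definedness on cosets of F(R) requires the multiplier as a p-th power: p^n
    - p = p (p^k - 1).\<close>
  define h where "h = f [^] (p ^ k - 1)"
  have h: "h \<in> carrier R" "h [^] p = f [^] (p ^ n - p)"
    unfolding h_def n using assms by (simp_all add: nat_pow_pow right_diff_distrib' mult.commute)
  have "Delta R p N x 1 f = frob_image R p +> d"
    using d(2)[of 0] d(1) by simp
  then show ?thesis using frob_quot_mult_coset[OF h(1) d(1)] d(2)[of k] unfolding h(2) n by simp
qed

end
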